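(* Let $m$ be a positive integer and let $W$ be an $n$-dimensional vector space over a finite field $\mathbb{F}_q$. Suppose $G\in\{\mathrm{GL}(W),\mathrm{SL}(W)\}$. Then there exists a set of homogeneous invariant polynomials $\{f_1,f_2,\dots,f_{mn}\}\subseteq \mathbb{F}_q[mW]^{G}$ such that $$\mathbb{F}_q(mW)^{G}=\mathbb{F}_q(f_1,f_2,\dots,f_{mn}).$$
   Context: $\mathbb{F}_q$ is a finite field of order $q$ (any characteristic $p>0$). $mW$ denotes the direct sum of $m$ copies of $W$. The group $G$ acts on $W$ in the standard way and on $mW$ diagonally. $\mathbb{F}_q[mW]$ is the ring of polynomial functions on $mW$ (a polynomial ring in $mn$ variables, graded by total degree) and $\mathbb{F}_q(mW)$ is its field of fractions, both with the induced action of $G$ by $\mathbb{F}_q$-algebra automorphisms. $\mathbb{F}_q[mW]^G$ and $\mathbb{F}_q(mW)^G$ denote the subring and subfield of $G$-fixed elements. *)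

theory Defs
  imports
    "HOL-Library.Poly_Mapping"
    "HOL-Library.Product_Lexorder"
    "HOL-Computational_Algebra.Fraction_Field"
    "HOL-Algebra.Generated_Fields"
    "HOL-Algebra.Algebraic_Closure_Type"
    "Jordan_Normal_Form.Determinant"
begin

text \<open>
  The vector space \<open>W\<close> is a type \<open>'w\<close> with scalar multiplication \<open>scale\<close>; \<open>b 0, \<dots>, b (n - 1)\<close>
  is an ordered basis. The library locale \<open>finite_dimensional_vector_space scale B\<close> says that
  \<open>scale\<close> is a vector space structure and that \<open>B\<close> is a finite basis of it.
\<close>

definition ordered_basis ::
    "('a::field \<Rightarrow> 'w::ab_group_add \<Rightarrow> 'w) \<Rightarrow> nat \<Rightarrow> (nat \<Rightarrow> 'w) \<Rightarrow> bool" where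
  "ordered_basis scale n b \<longleftrightarrow>
     finite_dimensional_vector_space scale (b ` {..<n}) \<and> inj_on b {..<n}"

lemma ordered_basis_imp_dim:
  assumes "ordered_basis scale n b"
  shows "vector_space.dim scale UNIV = n"
proof -
  interpret finite_dimensional_vector_space scale "b ` {..<n}"
    using assms by (simp add: ordered_basis_def)
  have "dim UNIV = card (b ` {..<n})"
    using dimension_def dim_UNIV by simp
  then show ?thesis
    using assms by (simp add: ordered_basis_def card_image)
qed

definition coord ::
    "('a::field \<Rightarrow> 'w::ab_group_add \<Rightarrow> 'w) \<Rightarrow> nat \<Rightarrow> (nat \<Rightarrow> 'w) \<Rightarrow> nat \<Rightarrow> 'w \<Rightarrow> 'a" where
  "coord scale n b j w = module.representation scale (b ` {..<n}) w (b j)"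

definition matrix_of ::
    "('a::field \<Rightarrow> 'w::ab_group_add \<Rightarrow> 'w) \<Rightarrow> nat \<Rightarrow> (nat \<Rightarrow> 'w) \<Rightarrow> ('w \<Rightarrow> 'w) \<Rightarrow> 'a mat" where
  "matrix_of scale n b g = mat n n (\<lambda>(i, j). coord scale n b i (g (b j)))"

definition GL_W :: "('a::field \<Rightarrow> 'w::ab_group_add \<Rightarrow> 'w) \<Rightarrow> ('w \<Rightarrow> 'w) set" where
  "GL_W scale = {g. Vector_Spaces.linear scale scale g \<and> bij g}"

text \<open>The determinant of an endomorphism does not depend on the basis used to compute it.\<close>

definition SL_W ::
    "('a::field \<Rightarrow> 'w::ab_group_add \<Rightarrow> 'w) \<Rightarrow> nat \<Rightarrow> (nat \<Rightarrow> 'w) \<Rightarrow> ('w \<Rightarrow> 'w) set" where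
  "SL_W scale n b = {g \<in> GL_W scale. det (matrix_of scale n b g) = 1}"

text \<open>
  Polynomials are finitely supported coefficient functions on monomials. The variable with index
  \<open>(i, j)\<close> is the coordinate function that sends \<open>(w\<^sub>0, \<dots>, w\<^sub>m\<^sub>-\<^sub>1)\<close> in \<open>mW\<close> to the \<open>j\<close>-th
  coordinate of \<open>w\<^sub>i\<close>. The type has variables for all pairs of natural numbers; the ring of
  polynomial functions on \<open>mW\<close> is the subring \<open>poly_mW m n\<close> of the polynomials in the variables
  with \<open>i < m\<close> and \<open>j < n\<close>. The lexicographic order on pairs serves only to make the polynomial
  ring an instance of class \<open>idom\<close>.
\<close>

type_synonym 'a mvpoly = "(nat \<times> nat \<Rightarrow>\<^sub>0 nat) \<Rightarrow>\<^sub>0 'a"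

definition const_poly :: "'a::field \<Rightarrow> 'a mvpoly" where
  "const_poly c = Poly_Mapping.single 0 c"

definition var_poly :: "nat \<times> nat \<Rightarrow> 'a::field mvpoly" where
  "var_poly v = Poly_Mapping.single (Poly_Mapping.single v 1) 1"

definition poly_mW :: "nat \<Rightarrow> nat \<Rightarrow> 'a::field mvpoly set" where
  "poly_mW m n = {p. \<forall>t \<in> Poly_Mapping.keys p. Poly_Mapping.keys t \<subseteq> {..<m} \<times> {..<n}}"

definition total_degree_monom :: "(nat \<times> nat \<Rightarrow>\<^sub>0 nat) \<Rightarrow> nat" where
  "total_degree_monom t = (\<Sum>v \<in> Poly_Mapping.keys t. Poly_Mapping.lookup t v)"

definition homogeneous_poly :: "'a::field mvpoly \<Rightarrow> bool" where
  "homogeneous_poly p \<longleftrightarrow> (\<exists>d. \<forall>t \<in> Poly_Mapping.keys p. total_degree_monom t = d)"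

definition frac_mW :: "nat \<Rightarrow> nat \<Rightarrow> 'a::field mvpoly fract set" where
  "frac_mW m n = {Fract p q | p q. p \<in> poly_mW m n \<and> q \<in> poly_mW m n \<and> q \<noteq> 0}"

definition subst_poly :: "(nat \<times> nat \<Rightarrow> 'a::field mvpoly) \<Rightarrow> 'a mvpoly \<Rightarrow> 'a mvpoly" where
  "subst_poly s p = (\<Sum>t \<in> Poly_Mapping.keys p.
     const_poly (Poly_Mapping.lookup p t) *
       (\<Prod>v \<in> Poly_Mapping.keys t. s v ^ Poly_Mapping.lookup t v))"

text \<open>
  The action induced by the diagonal action of \<open>g\<close> on \<open>mW\<close>, i.e. \<open>(g f)(w) = f (g\<^sup>-\<^sup>1 w)\<close>. It sends
  the coordinate function \<open>(i, j)\<close> to \<open>w \<mapsto> coord j (g\<^sup>-\<^sup>1 w\<^sub>i)\<close>, which is the linear form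
  \<open>\<Sum>k<n. coord j (g\<^sup>-\<^sup>1 (b k)) * x(i, k)\<close>.
\<close>

definition act_poly ::
    "('a::field \<Rightarrow> 'w::ab_group_add \<Rightarrow> 'w) \<Rightarrow> nat \<Rightarrow> (nat \<Rightarrow> 'w) \<Rightarrow> ('w \<Rightarrow> 'w) \<Rightarrow>
     'a mvpoly \<Rightarrow> 'a mvpoly" where
  "act_poly scale n b g =
     subst_poly (\<lambda>(i, j). \<Sum>k<n. const_poly (coord scale n b j (inv_into UNIV g (b k))) * var_poly (i, k))"

text \<open>The induced action on fractions, \<open>g (p / q) = g p / g q\<close>.\<close>

definition act_frac ::
    "('a::field \<Rightarrow> 'w::ab_group_add \<Rightarrow> 'w) \<Rightarrow> nat \<Rightarrow> nat \<Rightarrow> (nat \<Rightarrow> 'w) \<Rightarrow> ('w \<Rightarrow> 'w) \<Rightarrow>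
     'a mvpoly fract \<Rightarrow> 'a mvpoly fract" where
  "act_frac scale m n b g x =
     (THE y. \<exists>p \<in> poly_mW m n. \<exists>q \<in> poly_mW m n. q \<noteq> 0 \<and> x = Fract p q \<and>
        y = Fract (act_poly scale n b g p) (act_poly scale n b g q))"

definition invariant_polys ::
    "('a::field \<Rightarrow> 'w::ab_group_add \<Rightarrow> 'w) \<Rightarrow> nat \<Rightarrow> nat \<Rightarrow> (nat \<Rightarrow> 'w) \<Rightarrow> ('w \<Rightarrow> 'w) set \<Rightarrow>
     'a mvpoly set" where
  "invariant_polys scale m n b G =
     {p \<in> poly_mW m n. \<forall>g \<in> G. act_poly scale n b g p = p}"

definition invariant_field ::
    "('a::field \<Rightarrow> 'w::ab_group_add \<Rightarrow> 'w) \<Rightarrow> nat \<Rightarrow> nat \<Rightarrow> (nat \<Rightarrow> 'w) \<Rightarrow> ('w \<Rightarrow> 'w) set \<Rightarrow>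
     'a mvpoly fract set" where
  "invariant_field scale m n b G =
     {x \<in> frac_mW m n. \<forall>g \<in> G. act_frac scale m n b g x = x}"

text \<open>The subfield generated by the constants and a set of polynomials.\<close>

definition field_gen_by :: "'a::field mvpoly set \<Rightarrow> 'a mvpoly fract set" where
  "field_gen_by S =
     generate_field ring_of_type_algebra
       (range (\<lambda>c. Fract (const_poly c) 1) \<union> (\<lambda>p. Fract p 1) ` S)"

end

theory Submission
  imports Defs "HOL-Library.Cardinality"
begin

text \<open>
Let \<open>q\<close> be the number of scalars, let \<open>x = (x\<^sub>0, \<dots>, x\<^sub>n\<^sub>-\<^sub>1)\<close> be the coordinates on the first copy
of \<open>W\<close>, and let \<open>M\<close> be the Moore matrix with entries \<open>x\<^sub>j ^ q ^ k\<close> and determinant \<open>L\<close>. Since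
matrix entries of group elements are fixed by the \<open>q\<close>-th power map, every column of \<open>M\<close>
transforms under \<open>g\<close> like the vector \<open>x\<close> itself, and \<open>L\<close> is multiplied by the determinant of
\<open>g\<close> or its inverse. The matrix \<open>M\<close> is invertible (\<open>det_moore_nonzero\<close>). So a column vector \<open>z\<close> that
transforms like \<open>x\<close> is \<open>M u\<close> with \<open>u\<close> invariant, and by Cramer's rule \<open>u\<^sub>k = D\<^sub>k(z) / L\<close>, where
\<open>D\<^sub>k(z)\<close> is the determinant of \<open>M\<close> with column \<open>k\<close> replaced by \<open>z\<close>. The vectors used are the
other \<open>m - 1\<close> copies of the coordinates and the Frobenius power \<open>x ^ q ^ n\<close>; together these have \<open>m n\<close>
coefficients \<open>u\<^sub>k\<close>. To get polynomials, take \<open>e = q - 1\<close> for the general and \<open>e = 1\<close> for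
the special linear group, so that \<open>e\<close>-th powers of determinants are \<open>1\<close>. Then \<open>L ^ e\<close> and
\<open>L ^ (e - 1) D\<^sub>k(z)\<close> are homogeneous invariants, and their quotients are the \<open>u\<^sub>k\<close>. The
count stays at \<open>m n\<close> because the coefficient \<open>u\<^sub>0\<close> of \<open>x ^ q ^ n\<close> is \<open>L ^ (q - 1)\<close> up to sign
(\<open>cramer_det_frobenius_0\<close>), so that \<open>L ^ e\<close> takes its place in the list.

Let \<open>K\<close> be the field generated by these \<open>m n\<close> polynomials and the scalars. Adjoining
\<open>x\<^sub>0, \<dots>, x\<^sub>n\<^sub>-\<^sub>1\<close> to \<open>K\<close> gives the whole function field, since \<open>z = M u\<close> recovers the other
coordinates. It remains to show that an invariant \<open>f\<close> lies in \<open>K\<close>, and for this the \<open>x\<^sub>j\<close> are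
removed one at a time (\<open>mem_base_field_if_fixed\<close>). Put \<open>F = K(x\<^sub>0, \<dots>, x\<^sub>j\<^sub>-\<^sub>1)\<close>, and let \<open>V\<close> be
the span of all \<open>x\<^sub>i\<close> over the scalars and \<open>V'\<close> the span of \<open>x\<^sub>0, \<dots>, x\<^sub>j\<^sub>-\<^sub>1\<close>. Suppose that
\<open>f = P(x\<^sub>j) / Q(x\<^sub>j)\<close> with \<open>P\<close> and \<open>Q\<close> over \<open>F\<close>. Group elements that fix \<open>x\<^sub>0, \<dots>, x\<^sub>j\<^sub>-\<^sub>1\<close>
move \<open>x\<^sub>j\<close> to every element of \<open>V\<close> outside \<open>V'\<close> (\<open>elementary_reachable_nonzero\<close>), so
\<open>f Q(y) = P(y)\<close> for all such \<open>y\<close>. After multiplication by \<open>D = \<Prod>v\<in>V'. Y - v\<close>, which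
has coefficients in \<open>F\<close>, the equation \<open>f Q D = P D\<close> holds at all \<open>q ^ n\<close> elements of \<open>V\<close>. These are
the roots of a monic polynomial of degree \<open>q ^ n\<close> over \<open>K\<close>, namely
\<open>Y ^ q ^ n - (\<Sum>k<n. u\<^sub>k * Y ^ q ^ k)\<close> with the coefficients \<open>u\<^sub>k\<close> of \<open>x ^ q ^ n\<close>. Modulo this
polynomial, \<open>P D\<close> and \<open>Q D\<close> have remainders \<open>r\<close> and \<open>s\<close> over \<open>F\<close> of smaller degree with \<open>r = f s\<close>
on \<open>q ^ n\<close> points, hence as polynomials. Thus \<open>f\<close> is a quotient of two coefficients in \<open>F\<close>.

For the special linear group and the last index \<open>j = n - 1\<close> the orbit of \<open>x\<^sub>j\<close> is only the coset
\<open>x\<^sub>j + V'\<close> with \<open>q ^ (n - 1)\<close> elements. But then \<open>L\<close> is in \<open>K\<close>, and expanding \<open>L\<close> along the last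
row of \<open>M\<close> gives a polynomial of degree \<open>q ^ (n - 1)\<close> over \<open>F\<close> with exactly these roots, so that the same
argument applies.
\<close>

section \<open>The Frobenius map on an algebra over a finite field\<close>

text \<open>
Multiplication by a nonzero \<open>x\<close> permutes the nonzero elements, so it does not change their product.
\<close>

lemma power_card_eq_same:
  fixes x :: "'a::{field, finite}"
  shows "x ^ CARD('a) = x"
proof (cases "x = 0")
  case False
  have "x * (\<Prod>y\<in>UNIV - {0}. x * y) = x * x ^ (CARD('a) - 1) * \<Prod>(UNIV - {0})"
    by (simp add: prod.distrib mult_ac)
  also have "x * x ^ (CARD('a) - 1) = x ^ CARD('a)"
    by (metis power_minus_mult mult.commute zero_less_card_finite)
  also have "(\<Prod>y\<in>UNIV - {0}. x * y) = (\<Prod>y\<in>UNIV - {0}. y)"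
    by (rule prod.reindex_bij_witness[of _ "\<lambda>y. y / x" "\<lambda>y. x * y"]) (use False in auto)
  finally show ?thesis by simp
qed (simp add: zero_power)

text \<open>
The polynomial \<open>(X + 1) ^ q - X ^ q - 1\<close> has degree less than \<open>q\<close> and vanishes at all \<open>q\<close> elements
of the field, so its coefficients, the binomial coefficients in question, are zero.
\<close>

lemma of_nat_card_choose_eq_0:
  assumes "0 < i" "i < CARD('a::{field, finite})"
  shows "of_nat (CARD('a) choose i) = (0::'a)"
proof -
  define q where "q = CARD('a)"
  define p :: "'a poly" where "p = (\<Sum>k\<in>{1..<q}. monom (of_nat (q choose k)) k)"
  have coeff_p: "coeff p k = (if 0 < k \<and> k < q then of_nat (q choose k) else 0)" for k
    unfolding p_def by (simp add: coeff_sum)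
  then have "degree p < q"
    using assms by (intro degree_lessI) (auto simp: q_def)
  moreover have "poly p a = 0" for a
  proof -
    have "{..q} = insert 0 (insert q {1..<q})" and "q > 0"
      using assms by (auto simp: q_def)
    then have "(a + 1) ^ q = 1 + (a ^ q + poly p a)"
      unfolding binomial_ring by (simp add: p_def poly_sum poly_monom)
    then show ?thesis by (simp add: q_def power_card_eq_same)
  qed
  ultimately have "p = 0"
    using card_poly_roots_bound[of p] by (fastforce simp: q_def)
  then show ?thesis
    using coeff_p[of i] assms by (simp add: q_def)
qed

locale finite_field_algebra = comm_ring_hom \<iota>
  for \<iota> :: "'a::{field, finite} \<Rightarrow> 'b::comm_ring_1" +
  fixes q :: nat
  assumes q_eq: "q = CARD('a)"
begin

lemma q_gt_1: "q > 1"
  unfolding q_eq using card_mono[of "UNIV :: 'a set" "{0, 1}"] by simp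

lemma q_pos: "q > 0"
  using q_gt_1 by simp

lemma frobenius_add_1: "(u + v :: 'b) ^ q = u ^ q + v ^ q"
proof -
  have "of_nat (q choose k) * u ^ k * v ^ (q - k) = 0" if "k \<in> {..q} - {0, q}" for k
  proof -
    have "\<iota> (of_nat (q choose k)) = 0"
      using that of_nat_card_choose_eq_0[of k, where 'a = 'a] by (auto simp: q_eq)
    then show ?thesis by (simp add: hom_of_nat)
  qed
  then have "(u + v) ^ q = (\<Sum>k\<in>{0, q}. of_nat (q choose k) * u ^ k * v ^ (q - k))"
    unfolding binomial_ring by (intro sum.mono_neutral_right) auto
  then show ?thesis using q_gt_1 by (simp add: add.commute)
qed

lemma frobenius_add: "(u + v :: 'b) ^ q ^ k = u ^ q ^ k + v ^ q ^ k"
  by (induction k) (simp_all add: frobenius_add_1 power_mult mult.commute[of q])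

lemma frobenius_const: "\<iota> c ^ q ^ k = \<iota> c"
proof (induction k)
  case (Suc k)
  have "\<iota> c ^ q ^ Suc k = (\<iota> c ^ q ^ k) ^ q"
    by (simp add: power_mult mult.commute[of q])
  also have "\<dots> = \<iota> (c ^ q)"
    unfolding Suc hom_power ..
  also have "\<dots> = \<iota> c"
    unfolding q_eq power_card_eq_same ..
  finally show ?case .
qed simp

lemma frobenius_sum: "(\<Sum>j\<in>A. f j :: 'b) ^ q ^ k = (\<Sum>j\<in>A. f j ^ q ^ k)"
  by (induction A rule: infinite_finite_induct) (simp_all add: frobenius_add zero_power q_pos)

lemma frobenius_combination:
  "(\<Sum>j\<in>A. \<iota> (a j) * x j) ^ q ^ k = (\<Sum>j\<in>A. \<iota> (a j) * x j ^ q ^ k)"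
  by (simp add: frobenius_sum power_mult_distrib frobenius_const)

end

section \<open>Subfields and polynomials over them\<close>

text \<open>
Subfields of a field that is a type, as sets without a ring record. All coefficients below live in
such sets, while determinants and polynomials are formed over the whole type.
\<close>

locale subfield_set =
  fixes F :: "'b::field set"
  assumes one_mem: "1 \<in> F"
    and add_mem: "a \<in> F \<Longrightarrow> b \<in> F \<Longrightarrow> a + b \<in> F"
    and uminus_mem: "a \<in> F \<Longrightarrow> - a \<in> F"
    and mult_mem: "a \<in> F \<Longrightarrow> b \<in> F \<Longrightarrow> a * b \<in> F"
    and inverse_mem: "a \<in> F \<Longrightarrow> a \<noteq> 0 \<Longrightarrow> inverse a \<in> F"
begin

lemma zero_mem: "0 \<in> F"
  using add_mem[OF one_mem uminus_mem[OF one_mem]] by simp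

lemma diff_mem: "a \<in> F \<Longrightarrow> b \<in> F \<Longrightarrow> a - b \<in> F"
  using add_mem[OF _ uminus_mem] by fastforce

lemma divide_mem: "a \<in> F \<Longrightarrow> b \<in> F \<Longrightarrow> a / b \<in> F"
  unfolding divide_inverse using mult_mem inverse_mem zero_mem by (cases "b = 0") auto

lemma sum_mem: "(\<And>i. i \<in> A \<Longrightarrow> f i \<in> F) \<Longrightarrow> sum f A \<in> F"
  by (induction A rule: infinite_finite_induct) (auto intro: zero_mem add_mem)

lemma prod_mem: "(\<And>i. i \<in> A \<Longrightarrow> f i \<in> F) \<Longrightarrow> prod f A \<in> F"
  by (induction A rule: infinite_finite_induct) (auto intro: one_mem mult_mem)

lemma power_mem: "a \<in> F \<Longrightarrow> a ^ k \<in> F"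
  by (induction k) (auto intro: one_mem mult_mem)

lemma det_mem:
  assumes "\<And>i j. i < dim_row A \<Longrightarrow> j < dim_col A \<Longrightarrow> A $$ (i, j) \<in> F"
  shows "det A \<in> F"
proof (cases "dim_row A = dim_col A")
  case True
  have "signof p \<in> F" for p :: "nat \<Rightarrow> nat"
    using one_mem uminus_mem by (auto simp: sign_def)
  then show ?thesis
    unfolding det_def using True
    by (auto intro!: sum_mem mult_mem prod_mem assms simp: permutes_in_image)
qed (simp add: det_def zero_mem)

definition coeffs_in :: "'b poly \<Rightarrow> bool" where
  "coeffs_in p \<longleftrightarrow> (\<forall>i. coeff p i \<in> F)"

lemma coeffs_in_0: "coeffs_in 0"
  by (simp add: coeffs_in_def zero_mem)

lemma coeffs_in_pCons: "a \<in> F \<Longrightarrow> coeffs_in p \<Longrightarrow> coeffs_in (pCons a p)"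
  by (auto simp: coeffs_in_def coeff_pCons split: nat.split)

lemma coeffs_in_1: "coeffs_in 1"
  unfolding one_pCons by (intro coeffs_in_pCons one_mem coeffs_in_0)

lemma coeffs_in_add: "coeffs_in p \<Longrightarrow> coeffs_in r \<Longrightarrow> coeffs_in (p + r)"
  by (simp add: coeffs_in_def add_mem)

lemma coeffs_in_diff: "coeffs_in p \<Longrightarrow> coeffs_in r \<Longrightarrow> coeffs_in (p - r)"
  by (simp add: coeffs_in_def diff_mem)

lemma coeffs_in_smult: "c \<in> F \<Longrightarrow> coeffs_in p \<Longrightarrow> coeffs_in (Polynomial.smult c p)"
  by (simp add: coeffs_in_def mult_mem)

lemma coeffs_in_monom: "c \<in> F \<Longrightarrow> coeffs_in (monom c k)"
  by (simp add: coeffs_in_def zero_mem)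

lemma coeffs_in_mult: "coeffs_in p \<Longrightarrow> coeffs_in r \<Longrightarrow> coeffs_in (p * r)"
  by (simp add: coeffs_in_def coeff_mult sum_mem mult_mem)

lemma coeffs_in_sum: "(\<And>i. i \<in> A \<Longrightarrow> coeffs_in (f i)) \<Longrightarrow> coeffs_in (sum f A)"
  by (induction A rule: infinite_finite_induct) (auto intro: coeffs_in_0 coeffs_in_add)

lemma coeffs_in_prod: "(\<And>i. i \<in> A \<Longrightarrow> coeffs_in (f i)) \<Longrightarrow> coeffs_in (prod f A)"
  by (induction A rule: infinite_finite_induct) (auto intro: coeffs_in_1 coeffs_in_mult)

text \<open>
A monic divisor makes polynomial division a computation with ring operations on the coefficients,
so quotient and remainder stay over \<open>F\<close>. The proof builds the remainder coefficient by coefficient, as in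
Horner's scheme: multiply by the variable, add the next coefficient, and subtract the
multiple of \<open>\<Phi>\<close> that cancels the top term.
\<close>

lemma coeffs_in_remainder:
  assumes \<Phi>: "coeffs_in \<Phi>" "lead_coeff \<Phi> = 1" "degree \<Phi> > 0" and "coeffs_in p"
  shows "\<exists>r. coeffs_in r \<and> degree r < degree \<Phi> \<and> \<Phi> dvd p - r"
  using \<open>coeffs_in p\<close>
proof (induction p)
  case 0
  then show ?case using \<Phi> by (intro exI[of _ 0]) (auto intro: coeffs_in_0)
next
  case (pCons a p)
  have a: "a \<in> F" and "coeffs_in p"
    using pCons.prems unfolding coeffs_in_def coeff_pCons by (auto split: nat.splits)
  then obtain r s where r: "coeffs_in r" "degree r < degree \<Phi>" "p - r = \<Phi> * s"
    using pCons.IH by (metis dvdE)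
  define t where "t = pCons a r"
  define r' where "r' = t - Polynomial.smult (coeff t (degree \<Phi>)) \<Phi>"
  have t: "coeffs_in t" "degree t \<le> degree \<Phi>"
    using a r by (auto simp: t_def intro!: coeffs_in_pCons order_trans[OF degree_pCons_le])
  have "coeffs_in r'"
    unfolding r'_def using t \<Phi> by (intro coeffs_in_diff coeffs_in_smult) (auto simp: coeffs_in_def)
  moreover have "coeff r' k = 0" if "k \<ge> degree \<Phi>" for k
    using that t \<Phi> by (cases "k = degree \<Phi>") (auto simp: r'_def coeff_eq_0)
  then have "degree r' < degree \<Phi>"
    using \<Phi> by (intro degree_lessI) auto
  moreover have "pCons a p - t = \<Phi> * pCons 0 s"
    unfolding t_def diff_pCons r by simp
  then have "pCons a p - r' = \<Phi> * (pCons 0 s + [:coeff t (degree \<Phi>):])"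
    unfolding r'_def by (simp add: algebra_simps)
  then have "\<Phi> dvd pCons a p - r'"
    by (rule dvdI)
  ultimately show ?case by blast
qed

text \<open>
The source of all descent steps. The remainders \<open>r\<close> of \<open>P\<close> and \<open>s\<close> of \<open>Q\<close> modulo \<open>\<Phi>\<close>
satisfy \<open>f * s = r\<close> at more points than their degrees permit unless the two polynomials agree. So
\<open>f\<close> is a quotient of coefficients of \<open>r\<close> and \<open>s\<close>, which are in \<open>F\<close>. The point \<open>x\<close> ensures
that \<open>s\<close> is not zero.
\<close>

lemma mem_if_quotient_constant_on_roots:
  assumes \<Phi>: "coeffs_in \<Phi>" "lead_coeff \<Phi> = 1" "degree \<Phi> > 0"
    and Z: "finite Z" "card Z \<ge> degree \<Phi>" "\<And>y. y \<in> Z \<Longrightarrow> poly \<Phi> y = 0"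
    and PQ: "coeffs_in P" "coeffs_in Q" "\<And>y. y \<in> Z \<Longrightarrow> f * poly Q y = poly P y"
    and x: "x \<in> Z" "poly Q x \<noteq> 0"
  shows "f \<in> F"
proof -
  obtain r s where r: "coeffs_in r" "degree r < degree \<Phi>" "\<Phi> dvd P - r"
    and s: "coeffs_in s" "degree s < degree \<Phi>" "\<Phi> dvd Q - s"
    using coeffs_in_remainder[OF \<Phi>] PQ by meson
  have eq: "poly r y = poly P y" "poly s y = poly Q y" if "y \<in> Z" for y
    using Z(3)[OF that] r(3) s(3) by (auto elim!: dvdE simp: algebra_simps dest!: arg_cong[where f = "\<lambda>p. poly p y"])
  define d where "d = Polynomial.smult f s - r"
  have "d = 0"
  proof (rule ccontr)
    assume "d \<noteq> 0"
    then have "card Z \<le> degree d"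
      using card_mono[OF poly_roots_finite[of d], of Z] card_poly_roots_bound[of d] eq PQ(3)
      by (force simp: d_def)
    moreover have "degree d < degree \<Phi>"
      unfolding d_def using r s by (intro degree_diff_less) (auto intro: le_less_trans[OF degree_smult_le])
    ultimately show False using Z by simp
  qed
  then have rs: "coeff r i = f * coeff s i" for i
    by (metis d_def coeff_smult eq_iff_diff_eq_0)
  have "s \<noteq> 0" using eq x by auto
  then have "lead_coeff s \<noteq> 0" by simp
  then have "f = coeff r (degree s) / lead_coeff s"
    using rs[of "degree s"] by simp
  then show ?thesis using r s divide_mem by (metis coeffs_in_def)
qed

end

section \<open>Moore matrices\<close>

locale independent_family = finite_field_algebra \<iota> q
  for \<iota> :: "'a::{field, finite} \<Rightarrow> 'b::field" and q +
  fixes x :: "nat \<Rightarrow> 'b" and n :: nat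
  assumes independent: "(\<Sum>j<n. \<iota> (a j) * x j) = 0 \<Longrightarrow> j < n \<Longrightarrow> a j = 0"
begin

definition comb :: "nat \<Rightarrow> (nat \<Rightarrow> 'a) \<Rightarrow> 'b" where
  "comb k a = (\<Sum>j<k. \<iota> (a j) * x j)"

lemma comb_cong: "(\<And>j. j < k \<Longrightarrow> a j = a' j) \<Longrightarrow> comb k a = comb k a'"
  by (simp add: comb_def)

lemma comb_padded:
  assumes "k \<le> l"
  shows "comb l (\<lambda>j. if j < k then a j else 0) = comb k a"
  unfolding comb_def using assms by (intro sum.mono_neutral_cong_right) auto

lemma comb_unit: "j < k \<Longrightarrow> comb k (\<lambda>i. if i = j then 1 else 0) = x j"
  unfolding comb_def by (simp add: if_distrib[of \<iota>] if_distrib[of "\<lambda>c. c * _"] cong: if_cong)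

lemma comb_inj:
  assumes "k \<le> n" "comb k a = comb k a'" "j < k"
  shows "a j = a' j"
proof -
  have "comb k (\<lambda>j. a j - a' j) = 0"
    using assms by (simp add: comb_def hom_minus left_diff_distrib sum_subtractf)
  then have "comb n (\<lambda>j. if j < k then a j - a' j else 0) = 0"
    by (simp only: comb_padded[OF \<open>k \<le> n\<close>])
  from independent[OF this[unfolded comb_def], of j] show ?thesis
    using assms by simp
qed

lemma card_range_comb:
  assumes "k \<le> n"
  shows "finite (range (comb k))" "card (range (comb k)) = q ^ k"
proof -
  let ?S = "{..<k} \<rightarrow>\<^sub>E (UNIV :: 'a set)"
  have "comb k a \<in> comb k ` ?S" for a
  proof (rule image_eqI)
    show "comb k a = comb k (restrict a {..<k})" by (rule comb_cong) simp
  qed simp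
  then have eq: "range (comb k) = comb k ` ?S" by blast
  show "finite (range (comb k))"
    unfolding eq by (intro finite_imageI finite_PiE) auto
  have "inj_on (comb k) ?S"
    by (intro inj_onI PiE_ext[of _ "{..<k}" "\<lambda>_. UNIV"]) (auto dest: comb_inj[OF assms])
  then show "card (range (comb k)) = q ^ k"
    unfolding eq by (simp add: card_image card_PiE q_eq)
qed

definition moore :: "nat \<Rightarrow> 'b mat" where
  "moore k = mat k k (\<lambda>(j, i). x j ^ q ^ i)"

lemma moore_carrier [simp]: "moore k \<in> carrier_mat k k"
  by (simp add: moore_def)

text \<open>
A polynomial in which only the powers \<open>q ^ i\<close> occur is a linear function over the scalars, so it vanishes
on the span of its roots.
\<close>

lemma poly_linearized:
  assumes "\<And>j. j < k \<Longrightarrow> (\<Sum>i\<in>A. c i * x j ^ q ^ i) = 0"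
  shows "(\<Sum>i\<in>A. c i * comb k a ^ q ^ i) = 0"
proof -
  have "(\<Sum>i\<in>A. c i * comb k a ^ q ^ i) = (\<Sum>j<k. \<iota> (a j) * (\<Sum>i\<in>A. c i * x j ^ q ^ i))"
    unfolding comb_def frobenius_combination sum_distrib_left
    by (subst sum.swap) (simp add: mult_ac)
  then show ?thesis using assms by simp
qed

text \<open>
A linear relation between the columns is a nonzero polynomial of degree at most \<open>q ^ (k - 1)\<close>
that vanishes at \<open>x 0, \<dots>, x (k - 1)\<close>, hence on their span, which has \<open>q ^ k\<close> elements.
\<close>

lemma det_moore_nonzero:
  assumes "k \<le> n"
  shows "det (moore k) \<noteq> 0"
proof
  assume "det (moore k) = 0"
  then obtain v where v: "v \<in> carrier_vec k" "v \<noteq> 0\<^sub>v k" "moore k *\<^sub>v v = 0\<^sub>v k"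
    using det_0_iff_vec_prod_zero_field[OF moore_carrier] by blast
  define p where "p = (\<Sum>i<k. monom (v $ i) (q ^ i))"
  have "(\<Sum>i<k. v $ i * x j ^ q ^ i) = (moore k *\<^sub>v v) $ j" if "j < k" for j
    using that v(1) by (simp add: moore_def scalar_prod_def lessThan_atLeast0 mult.commute)
  then have "(\<Sum>i<k. v $ i * comb k a ^ q ^ i) = 0" for a
    using v(3) by (intro poly_linearized) simp
  then have roots: "range (comb k) \<subseteq> {y. poly p y = 0}"
    by (auto simp: p_def poly_sum poly_monom)
  obtain i where i: "i < k" "v $ i \<noteq> 0"
    using v by (metis carrier_vecD eq_vecI index_zero_vec)
  have coeff_p: "coeff p (q ^ l) = (if l < k then v $ l else 0)" for l
    unfolding p_def using q_gt_1 by (simp add: coeff_sum power_inject_exp)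
  then have "p \<noteq> 0" using i by (metis coeff_0)
  have "degree p < q ^ k"
  proof (rule degree_lessI)
    show "p \<noteq> 0 \<or> q ^ k > 0" using \<open>p \<noteq> 0\<close> by simp
    show "\<forall>l\<ge>q ^ k. coeff p l = 0"
      using q_gt_1 by (auto simp: p_def coeff_sum intro!: sum.neutral dest: power_strict_increasing[of _ _ q])
  qed
  moreover have "q ^ k \<le> degree p"
    using card_mono[OF poly_roots_finite[OF \<open>p \<noteq> 0\<close>] roots] card_poly_roots_bound[OF \<open>p \<noteq> 0\<close>]
      card_range_comb[OF assms] by simp
  ultimately show False by simp
qed

definition cramer_det :: "(nat \<Rightarrow> 'b) \<Rightarrow> nat \<Rightarrow> 'b" where
  "cramer_det z k = det (replace_col (moore n) (vec n z) k)"

definition moore_coeff :: "(nat \<Rightarrow> 'b) \<Rightarrow> nat \<Rightarrow> 'b" where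
  "moore_coeff z k = cramer_det z k / det (moore n)"

text \<open>
Cramer's rule: \<open>moore_coeff z\<close> is the solution of the linear system with the Moore matrix and
right-hand side \<open>z\<close>.
\<close>

lemma moore_coeff_expansion:
  assumes "j < n"
  shows "z j = (\<Sum>k<n. moore_coeff z k * x j ^ q ^ k)"
proof -
  have "det (moore n) \<noteq> 0" by (rule det_moore_nonzero) simp
  then obtain B where B: "B \<in> carrier_mat n n" "moore n * B = 1\<^sub>m n"
    using det_non_zero_imp_unit[OF moore_carrier, of n "()"]
    unfolding Units_def ring_mat_def by auto
  define v where "v = B *\<^sub>v vec n z"
  have v: "v \<in> carrier_vec n" using B by (auto simp: v_def)
  have "moore n *\<^sub>v v = (moore n * B) *\<^sub>v vec n z"
    unfolding v_def using B by (intro assoc_mult_mat_vec[OF moore_carrier, symmetric]) auto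
  then have mv: "moore n *\<^sub>v v = vec n z" using B by simp
  have "moore_coeff z k = v $ k" if "k < n" for k
    using cramer_lemma_mat[OF moore_carrier v that] \<open>det (moore n) \<noteq> 0\<close>
    by (simp add: mv moore_coeff_def cramer_det_def)
  moreover have "z j = (moore n *\<^sub>v v) $ j" using assms by (simp add: mv)
  ultimately show ?thesis
    using assms v by (simp add: moore_def scalar_prod_def lessThan_atLeast0 mult.commute)
qed

text \<open>
Replacing the first column by \<open>x ^ q ^ n\<close> leaves the columns \<open>x ^ q ^ n, x ^ q, \<dots>, x ^ q ^ (n - 1)\<close>. Up
to a cyclic permutation these are the \<open>q\<close>-th powers of the columns of the Moore matrix, and the
\<open>q\<close>-th power map is a ring homomorphism.
\<close>

lemma cramer_det_frobenius_0:
  assumes "n > 0"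
  shows "cramer_det (\<lambda>j. x j ^ q ^ n) 0 \<in> {det (moore n) ^ q, - (det (moore n) ^ q)}"
proof -
  interpret frob: comm_ring_hom "\<lambda>u :: 'b. u ^ q"
    by unfold_locales (auto simp: frobenius_add_1 power_mult_distrib q_pos)
  define p where "p i = (if i < n then (if i = 0 then n - 1 else i - 1) else i)" for i
  have p: "p permutes {0..<n}"
  proof (rule bij_imp_permutes)
    show "bij_betw p {0..<n} {0..<n}"
      by (rule bij_betw_byWitness[where f' = "\<lambda>i. if i = n - 1 then 0 else Suc i"])
        (use assms in \<open>auto simp: p_def\<close>)
  qed (simp add: p_def)
  define A where "A = transpose_mat (map_mat (\<lambda>u. u ^ q) (moore n))"
  have A: "A \<in> carrier_mat n n" by (simp add: A_def)
  have "det A = det (moore n) ^ q"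
    unfolding A_def by (simp add: det_transpose[of _ n] frob.hom_det)
  moreover have "transpose_mat (replace_col (moore n) (vec n (\<lambda>j. x j ^ q ^ n)) 0)
      = mat n n (\<lambda>(i, j). A $$ (p i, j))"
  proof (rule eq_matI)
    fix i j
    assume "i < dim_row (mat n n (\<lambda>(i, j). A $$ (p i, j)))" "j < dim_col (mat n n (\<lambda>(i, j). A $$ (p i, j)))"
    then have ij: "i < n" "j < n" by auto
    have pow: "(x j ^ q ^ l) ^ q = x j ^ q ^ Suc l" for l
      by (metis power_Suc2 power_mult)
    show "transpose_mat (replace_col (moore n) (vec n (\<lambda>j. x j ^ q ^ n)) 0) $$ (i, j)
        = mat n n (\<lambda>(i, j). A $$ (p i, j)) $$ (i, j)"
      using ij assms pow[of "n - 1"] pow[of "i - 1"]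
      by (cases "i = 0") (simp_all add: A_def moore_def replace_col_def p_def del: power_Suc)
  qed (simp_all add: replace_col_def moore_def)
  moreover have "replace_col (moore n) (vec n (\<lambda>j. x j ^ q ^ n)) 0 \<in> carrier_mat n n"
    by (simp add: replace_col_def carrier_matI moore_def)
  ultimately have "cramer_det (\<lambda>j. x j ^ q ^ n) 0 = signof p * det (moore n) ^ q"
    unfolding cramer_det_def using det_permute_rows[OF A p] det_transpose by metis
  then show ?thesis by (auto simp: sign_def)
qed

text \<open>
This is the product of \<open>Y - v\<close> over all \<open>v\<close> in the span of \<open>x 0, \<dots>, x (n - 1)\<close>; its coefficients
are the Dickson invariants up to sign. It is written with the Cramer coefficients in order to show that it is
defined over any field that contains them.
\<close>

definition span_poly :: "'b poly" where
  "span_poly = monom 1 (q ^ n) - (\<Sum>k<n. monom (moore_coeff (\<lambda>j. x j ^ q ^ n) k) (q ^ k))"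

lemma degree_span_poly: "degree span_poly = q ^ n" "lead_coeff span_poly = 1"
proof -
  have 1: "coeff span_poly l = (if l = q ^ n then 1 else 0)" if "l \<ge> q ^ n" for l
  proof -
    have "q ^ k \<noteq> l" if "k < n" for k
      using power_strict_increasing[OF that q_gt_1] \<open>l \<ge> q ^ n\<close> by simp
    then show ?thesis
      unfolding span_poly_def by (auto simp: coeff_sum intro!: sum.neutral)
  qed
  show "degree span_poly = q ^ n"
    by (intro antisym degree_le le_degree) (auto simp: 1)
  then show "lead_coeff span_poly = 1" by (simp add: 1)
qed

lemma span_poly_root: "poly span_poly (comb n a) = 0"
proof -
  define c where "c k = (if k = n then 1 else - moore_coeff (\<lambda>j. x j ^ q ^ n) k)" for k
  have "poly span_poly y = (\<Sum>k\<le>n. c k * y ^ q ^ k)" for y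
    by (simp add: span_poly_def poly_sum poly_monom c_def lessThan_Suc_atMost[symmetric] sum_negf)
  moreover have "(\<Sum>k\<le>n. c k * x j ^ q ^ k) = 0" if "j < n" for j
    using moore_coeff_expansion[OF that, of "\<lambda>j. x j ^ q ^ n"]
    by (simp add: c_def lessThan_Suc_atMost[symmetric] sum_negf)
  ultimately show ?thesis using poly_linearized by simp
qed

text \<open>
The equation \<open>f * Q = P\<close> is given only outside the span of \<open>x 0, \<dots>, x (j - 1)\<close>. Multiplying it by
the product \<open>D\<close> of \<open>Y - v\<close> over this smaller span, whose elements are in \<open>F\<close>, makes it true
on the whole span, which is the root set of \<open>span_poly\<close>.
\<close>

lemma mem_subfield_if_constant_off_span:
  assumes "subfield_set F" and \<iota>: "range \<iota> \<subseteq> F"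
    and j: "j < n" "\<And>k. k < j \<Longrightarrow> x k \<in> F"
    and coeffs: "\<And>k. k < n \<Longrightarrow> moore_coeff (\<lambda>j. x j ^ q ^ n) k \<in> F"
    and PQ: "subfield_set.coeffs_in F P" "subfield_set.coeffs_in F Q"
    and eq: "\<And>a. comb n a \<notin> range (comb j) \<Longrightarrow> f * poly Q (comb n a) = poly P (comb n a)"
    and Q: "poly Q (x j) \<noteq> 0"
  shows "f \<in> F"
proof -
  interpret subfield_set F by fact
  define D where "D = (\<Prod>v\<in>range (comb j). [:- v, 1:])"
  have fin: "finite (range (comb j))" using card_range_comb(1) j by simp
  have poly_D: "poly D y = 0 \<longleftrightarrow> y \<in> range (comb j)" for y
    using fin by (auto simp: D_def poly_prod)
  have D: "coeffs_in D"
    unfolding D_def comb_def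
    by (intro coeffs_in_prod coeffs_in_pCons coeffs_in_0 uminus_mem one_mem)
      (use j \<iota> in \<open>auto intro!: sum_mem mult_mem\<close>)
  have xj: "x j = comb n (\<lambda>i. if i = j then 1 else 0)"
    using comb_unit j by simp
  have "x j \<notin> range (comb j)"
  proof
    assume "x j \<in> range (comb j)"
    then obtain a where "x j = comb j a" by auto
    then have "comb n (\<lambda>i. if i = j then 1 else 0) = comb n (\<lambda>i. if i < j then a i else 0)"
      using comb_padded[of j n a] j xj by simp
    from comb_inj[OF order_refl this, of j] j show False by simp
  qed
  show ?thesis
  proof (rule mem_if_quotient_constant_on_roots[of span_poly "range (comb n)" "P * D" "Q * D" f "x j"])
    show "coeffs_in span_poly"
      unfolding span_poly_def
      by (intro coeffs_in_diff coeffs_in_sum coeffs_in_monom one_mem coeffs) simp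
    show "f * poly (Q * D) y = poly (P * D) y" if "y \<in> range (comb n)" for y
      using that eq poly_D by (cases "y \<in> range (comb j)") (auto simp: mult.assoc[symmetric])
    show "poly (Q * D) (x j) \<noteq> 0"
      using Q poly_D \<open>x j \<notin> range (comb j)\<close> by simp
    show "x j \<in> range (comb n)"
      by (subst xj) (rule rangeI)
    show "coeffs_in (P * D)" "coeffs_in (Q * D)"
      using PQ D by (auto intro: coeffs_in_mult)
    show "poly span_poly y = 0" if "y \<in> range (comb n)" for y
      using that span_poly_root by auto
  qed (use degree_span_poly in \<open>simp_all add: card_range_comb q_pos\<close>)
qed

text \<open>
Here the points are those of a coset of the span of \<open>x 0, \<dots>, x (j - 1)\<close> for the last index \<open>j\<close>. The
expansion of the Moore determinant along its last row, with \<open>x j\<close> replaced by a variable, is a polynomial of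
degree \<open>q ^ j\<close>. Its coefficients are minors that do not involve \<open>x j\<close>, and it takes
the value \<open>det (moore n)\<close> on the coset because it is additive and vanishes on the span.
\<close>

lemma mem_subfield_if_constant_on_coset:
  assumes "subfield_set F" and \<iota>: "range \<iota> \<subseteq> F"
    and j: "n = Suc j" "\<And>k. k < j \<Longrightarrow> x k \<in> F"
    and L: "det (moore n) \<in> F"
    and PQ: "subfield_set.coeffs_in F P" "subfield_set.coeffs_in F Q"
    and eq: "\<And>a. f * poly Q (x j + comb j a) = poly P (x j + comb j a)"
    and Q: "poly Q (x j) \<noteq> 0"
  shows "f \<in> F"
proof -
  interpret subfield_set F by fact
  define C where "C k = cofactor (moore n) j k" for k
  have C_mem: "C k \<in> F" for k
    unfolding C_def cofactor_def
    by (intro mult_mem power_mem uminus_mem one_mem det_mem)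
      (use j in \<open>auto simp: mat_delete_def moore_def intro!: power_mem\<close>)
  have "mat_delete (moore n) j j = moore j"
    by (intro eq_matI) (auto simp: mat_delete_def moore_def j)
  then have Cj: "C j = det (moore j)"
    by (simp add: C_def cofactor_def)
  then have "C j \<noteq> 0" using det_moore_nonzero[of j] j by simp
  have L_eq: "det (moore n) = (\<Sum>k<n. C k * x j ^ q ^ k)"
    unfolding C_def using laplace_expansion_row[OF moore_carrier[of n], of j] j
    by (simp add: moore_def mult.commute)
  \<comment> \<open>This is the expansion of a determinant whose rows \<open>i\<close> and \<open>j\<close> are equal.\<close>
  have vanish: "(\<Sum>k<n. C k * x i ^ q ^ k) = 0" if "i < j" for i
  proof -
    define A where "A = mat n n (\<lambda>(r, k). x (if r = j then i else r) ^ q ^ k)"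
    have A: "A \<in> carrier_mat n n" by (simp add: A_def)
    have "det A = 0"
      using that j by (intro det_identical_rows[OF A, of i j]) (auto simp: A_def intro!: eq_vecI)
    moreover have "cofactor A j k = C k" if "k < n" for k
    proof -
      have "mat_delete A j k = mat_delete (moore n) j k"
        using j by (intro eq_matI) (auto simp: A_def mat_delete_def moore_def)
      then show ?thesis by (simp add: C_def cofactor_def)
    qed
    ultimately show ?thesis
      using laplace_expansion_row[OF A, of j] j by (simp add: A_def mult.commute)
  qed
  define \<Phi> where "\<Phi> = Polynomial.smult (inverse (C j)) ((\<Sum>k<n. monom (C k) (q ^ k)) - [:det (moore n):])"
  have coeff_\<Phi>: "coeff \<Phi> l = (if l = q ^ j then 1 else 0)" if "l \<ge> q ^ j" for l
  proof -
    have neq: "q ^ k \<noteq> l" if "k < j" for k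
      using power_strict_increasing[OF that q_gt_1] \<open>l \<ge> q ^ j\<close> by simp
    have "(\<Sum>k<n. coeff (monom (C k) (q ^ k)) l) = (if l = q ^ j then C j else 0)"
    proof -
      have "(\<Sum>k<j. coeff (monom (C k) (q ^ k)) l) = 0"
        using neq by (intro sum.neutral) auto
      then show ?thesis by (simp add: j)
    qed
    moreover have "l \<noteq> 0" using that q_pos by (metis le_zero_eq neq0_conv power_not_zero)
    ultimately show ?thesis
      using \<open>C j \<noteq> 0\<close> q_pos by (cases l) (simp_all add: \<Phi>_def coeff_sum)
  qed
  have deg: "degree \<Phi> = q ^ j"
    by (intro antisym degree_le le_degree) (auto simp: coeff_\<Phi>)
  have inj: "inj ((+) (x j))" by simp
  have card: "card ((+) (x j) ` range (comb j)) = q ^ j"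
    using card_range_comb(2)[of j] j by (simp add: card_image[OF inj_on_subset[OF inj]])
  have root: "poly \<Phi> (x j + comb j a) = 0" for a
  proof -
    have "(\<Sum>k<n. C k * (x j + comb j a) ^ q ^ k) = det (moore n)"
      using poly_linearized[of j C "{..<n}" a, OF vanish]
      by (simp add: frobenius_add distrib_left sum.distrib L_eq)
    then show ?thesis by (simp add: \<Phi>_def poly_sum poly_monom)
  qed
  show ?thesis
  proof (rule mem_if_quotient_constant_on_roots[of \<Phi> "(+) (x j) ` range (comb j)" P Q f "x j"])
    show "coeffs_in \<Phi>"
      unfolding \<Phi>_def
      by (intro coeffs_in_smult coeffs_in_diff coeffs_in_sum coeffs_in_monom coeffs_in_pCons coeffs_in_0
          inverse_mem C_mem L \<open>C j \<noteq> 0\<close>)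
    show "x j \<in> (+) (x j) ` range (comb j)"
      by (rule image_eqI[of _ _ 0]) (auto intro!: image_eqI[of _ _ "\<lambda>_. 0"] simp: comb_def)
    show "finite ((+) (x j) ` range (comb j))"
      using card_range_comb(1)[of j] j by simp
    show "degree \<Phi> \<le> card ((+) (x j) ` range (comb j))"
      unfolding deg card ..
    show "poly \<Phi> y = 0" "f * poly Q y = poly P y" if "y \<in> (+) (x j) ` range (comb j)" for y
      using that root eq by auto
  qed (simp_all add: deg coeff_\<Phi> q_pos PQ Q)
qed

end

section \<open>Elementary substitutions act transitively\<close>

text \<open>
Let \<open>a\<close> be the coefficient vector of a linear combination of \<open>x 0, \<dots>, x (n - 1)\<close>. The operation in
\<open>closed\<close> is what the substitution \<open>x l \<mapsto> \<Sum>k<n. r k * x k\<close> does to \<open>a\<close>; for \<open>l \<ge> j\<close> it fixes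
\<open>x 0, \<dots>, x (j - 1)\<close>. The predicate \<open>allowed\<close> restricts the determinant \<open>r l\<close> of this substitution, to \<open>1\<close> or
to nonzero values. A single substitution of \<open>x j\<close> reaches all \<open>a\<close> with \<open>a j\<close> allowed. If some
coefficient after position \<open>j\<close> is nonzero, a second substitution of that variable
corrects the value at \<open>j\<close>. If \<open>a j\<close> is the only nonzero coefficient from \<open>j\<close> on, an auxiliary coefficient \<open>1\<close> is put
at \<open>j + 1\<close> and then removed by substituting for \<open>x j\<close>.
\<close>

lemma elementary_reachable:
  fixes S :: "(nat \<Rightarrow> 'a::field) set"
  assumes start: "(\<lambda>i. if i = j then 1 else 0) \<in> S"
    and closed: "\<And>a l r. a \<in> S \<Longrightarrow> j \<le> l \<Longrightarrow> l < n \<Longrightarrow> allowed (r l) \<Longrightarrow>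
      (\<lambda>k. (if k = l then 0 else a k) + a l * r k) \<in> S"
    and "j < n"
  shows elementary_reachable_allowed: "allowed (a j) \<Longrightarrow> a \<in> S"
    and elementary_reachable_nonzero:
      "allowed 1 \<Longrightarrow> Suc j < n \<or> (\<forall>c. c \<noteq> 0 \<longrightarrow> allowed c) \<Longrightarrow> j \<le> k \<Longrightarrow> k < n \<Longrightarrow> a k \<noteq> 0 \<Longrightarrow> a \<in> S"
proof -
  have allowed: "a \<in> S" if "allowed (a j)" for a
    using closed[OF start order_refl \<open>j < n\<close>, of a, OF that] by (simp cong: if_cong)
  then show "allowed (a j) \<Longrightarrow> a \<in> S" .
  have later: "a \<in> S" if "allowed 1" "j < k" "k < n" "a k \<noteq> 0" for a k
  proof -
    have "a(j := 1) \<in> S" using allowed[of "a(j := 1)"] \<open>allowed 1\<close> by simp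
    from closed[OF this, of k "\<lambda>i. if i = k then 1 else if i = j then (a j - 1) / a k else 0"]
    have "(\<lambda>i. (if i = k then 0 else (a(j := 1)) i) +
        (a(j := 1)) k * (if i = k then 1 else if i = j then (a j - 1) / a k else 0)) \<in> S"
      using that by simp
    also have "(\<lambda>i. (if i = k then 0 else (a(j := 1)) i) +
        (a(j := 1)) k * (if i = k then 1 else if i = j then (a j - 1) / a k else 0)) = a"
      using that by auto
    finally show ?thesis .
  qed
  assume 1: "allowed 1" and last: "Suc j < n \<or> (\<forall>c. c \<noteq> 0 \<longrightarrow> allowed c)"
    and k: "j \<le> k" "k < n" "a k \<noteq> 0"
  consider "j < k" | "k = j" "\<forall>c. c \<noteq> 0 \<longrightarrow> allowed c" | "k = j" "Suc j < n" "a (Suc j) \<noteq> 0"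
    | "k = j" "Suc j < n" "a (Suc j) = 0"
    using last k by fastforce
  then show "a \<in> S"
  proof cases
    case 1
    then show ?thesis using later \<open>allowed 1\<close> k by blast
  next
    case 2
    then show ?thesis using allowed k by blast
  next
    case 3
    then show ?thesis using later[of "Suc j"] \<open>allowed 1\<close> by simp
  next
    case 4
    have "a(Suc j := 1) \<in> S" using later[of "Suc j" "a(Suc j := 1)"] \<open>allowed 1\<close> 4 by simp
    from closed[OF this, of j "\<lambda>i. if i = j then 1 else if i = Suc j then - inverse (a j) else 0"]
    have "(\<lambda>i. (if i = j then 0 else (a(Suc j := 1)) i) +
        (a(Suc j := 1)) j * (if i = j then 1 else if i = Suc j then - inverse (a j) else 0)) \<in> S"
      using \<open>allowed 1\<close> k by simp
    also have "(\<lambda>i. (if i = j then 0 else (a(Suc j := 1)) i) +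
        (a(Suc j := 1)) j * (if i = j then 1 else if i = Suc j then - inverse (a j) else 0)) = a"
      using 4 k by (auto simp: fun_eq_iff)
    finally show ?thesis .
  qed
qed

section \<open>Fields generated in a type\<close>

lemma ring_of_type_algebra_simps [simp]:
  "carrier ring_of_type_algebra = UNIV" "monoid.mult ring_of_type_algebra = (*)"
  "one ring_of_type_algebra = 1" "zero ring_of_type_algebra = 0" "add ring_of_type_algebra = (+)"
  by (auto simp: ring_of_type_algebra_def)

lemma inv_ring_of_type_algebra:
  assumes "x \<noteq> (0::'b::field)"
  shows "inv\<^bsub>ring_of_type_algebra\<^esub> x = inverse x"
proof -
  interpret R: Ring.field "ring_of_type_algebra :: 'b ring" by (rule field_from_type_algebra)
  show ?thesis
    using assms R.inv_char[of x "inverse x"] by simp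
qed

lemma a_inv_ring_of_type_algebra: "\<ominus>\<^bsub>ring_of_type_algebra\<^esub> x = - (x::'b::field)"
proof -
  interpret R: Ring.field "ring_of_type_algebra :: 'b ring" by (rule field_from_type_algebra)
  show ?thesis
    using R.minus_equality[of "- x" x] by simp
qed

abbreviation gen_field :: "'b::field set \<Rightarrow> 'b set" where
  "gen_field \<equiv> generate_field ring_of_type_algebra"

lemma subfield_set_gen_field: "subfield_set (gen_field H)"
proof
  fix a b assume "a \<in> gen_field H" "b \<in> gen_field H"
  then show "a + b \<in> gen_field H" "a * b \<in> gen_field H"
    using generate_field.eng_add[of a ring_of_type_algebra H b]
      generate_field.eng_mult[of a ring_of_type_algebra H b] by simp_all
next
  fix a assume a: "a \<in> gen_field H"
  then show "- a \<in> gen_field H"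
    using generate_field.a_inv[of a ring_of_type_algebra H] by (simp add: a_inv_ring_of_type_algebra)
  show "inverse a \<in> gen_field H" if "a \<noteq> 0"
    using a that generate_field.m_inv[of a ring_of_type_algebra H] by (simp add: inv_ring_of_type_algebra)
qed (use generate_field.one[of ring_of_type_algebra H] in simp)

lemma gen_field_subset:
  assumes "subfield_set F" "H \<subseteq> F"
  shows "gen_field H \<subseteq> F"
proof
  interpret subfield_set F by fact
  fix a assume "a \<in> gen_field H"
  then show "a \<in> F"
    by induction
      (use \<open>H \<subseteq> F\<close> in \<open>auto simp: a_inv_ring_of_type_algebra inv_ring_of_type_algebra
        intro: one_mem add_mem mult_mem uminus_mem inverse_mem\<close>)
qed

lemma gen_field_mono: "H \<subseteq> H' \<Longrightarrow> gen_field H \<subseteq> gen_field H'"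
  by (intro gen_field_subset subfield_set_gen_field) (auto intro: generate_field.incl)

text \<open>
Quotients of polynomials in \<open>h\<close>, rather than polynomials, are used since they form a field whether or not
\<open>h\<close> is algebraic over the smaller field.
\<close>

lemma gen_field_insert_quotient:
  assumes "f \<in> gen_field (insert h H)"
  shows "\<exists>P Q. subfield_set.coeffs_in (gen_field H) P \<and> subfield_set.coeffs_in (gen_field H) Q \<and>
    poly Q h \<noteq> 0 \<and> f * poly Q h = poly P h"
proof -
  interpret subfield_set "gen_field H" by (rule subfield_set_gen_field)
  define F where "F = {poly P h / poly Q h | P Q. coeffs_in P \<and> coeffs_in Q \<and> poly Q h \<noteq> 0}"
  have FI: "f \<in> F" if "coeffs_in P" "coeffs_in Q" "poly Q h \<noteq> 0" "f = poly P h / poly Q h" for f P Q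
    using that by (auto simp: F_def)
  have const: "c \<in> F" if "c \<in> gen_field H" for c
    using that by (intro FI[of "[:c:]" 1]) (auto intro: coeffs_in_pCons coeffs_in_0 coeffs_in_1)
  have "subfield_set F"
  proof
    show "1 \<in> F" by (intro const one_mem)
    fix a assume "a \<in> F"
    then obtain P Q where a: "coeffs_in P" "coeffs_in Q" "poly Q h \<noteq> 0" "a = poly P h / poly Q h"
      by (auto simp: F_def)
    show "- a \<in> F"
      using a by (intro FI[of "- P" Q]) (auto simp: coeffs_in_def intro: uminus_mem)
    show "inverse a \<in> F" if "a \<noteq> 0"
      using a that by (intro FI[of Q P]) auto
    fix b assume "b \<in> F"
    then obtain P' Q' where b: "coeffs_in P'" "coeffs_in Q'" "poly Q' h \<noteq> 0" "b = poly P' h / poly Q' h"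
      by (auto simp: F_def)
    show "a + b \<in> F"
      using a b by (intro FI[of "P * Q' + P' * Q" "Q * Q'"])
        (auto intro: coeffs_in_add coeffs_in_mult simp: add_frac_eq)
    show "a * b \<in> F"
      using a b by (intro FI[of "P * P'" "Q * Q'"]) (auto intro: coeffs_in_mult)
  qed
  moreover have "insert h H \<subseteq> F"
  proof -
    have "h \<in> F"
      by (intro FI[of "[:0, 1:]" 1]) (auto intro!: coeffs_in_pCons coeffs_in_0 coeffs_in_1 zero_mem one_mem)
    then show ?thesis using const by (auto intro: generate_field.incl)
  qed
  ultimately have "f \<in> F" using gen_field_subset assms by blast
  then obtain P Q where "coeffs_in P" "coeffs_in Q" "poly Q h \<noteq> 0" "f = poly P h / poly Q h"
    by (auto simp: F_def)
  then show ?thesis by (intro exI[of _ P] exI[of _ Q]) simp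
qed

section \<open>Polynomials and substitution homomorphisms\<close>

definition monom_value :: "(nat \<times> nat \<Rightarrow> 'a::field mvpoly) \<Rightarrow> (nat \<times> nat \<Rightarrow>\<^sub>0 nat) \<Rightarrow> 'a mvpoly" where
  "monom_value s t = (\<Prod>v\<in>Poly_Mapping.keys t. s v ^ Poly_Mapping.lookup t v)"

lemma monom_value_superset:
  assumes "finite V" "Poly_Mapping.keys t \<subseteq> V"
  shows "monom_value s t = (\<Prod>v\<in>V. s v ^ Poly_Mapping.lookup t v)"
  unfolding monom_value_def
  using assms by (intro prod.mono_neutral_left) (auto simp: in_keys_iff)

lemma monom_value_add: "monom_value s (t + u) = monom_value s t * monom_value s u"
proof -
  let ?V = "Poly_Mapping.keys t \<union> Poly_Mapping.keys u"
  have "monom_value s w = (\<Prod>v\<in>?V. s v ^ Poly_Mapping.lookup w v)"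
    if "Poly_Mapping.keys w \<subseteq> ?V" for w
    using that by (intro monom_value_superset) auto
  then show ?thesis
    using keys_add[of t u] by (simp add: lookup_add power_add prod.distrib)
qed

lemma monom_value_0 [simp]: "monom_value s 0 = 1"
  by (simp add: monom_value_def)

interpretation const_poly: comm_ring_hom "const_poly :: 'a::field \<Rightarrow> 'a mvpoly"
  by unfold_locales (simp_all add: const_poly_def single_add mult_single)

lemma subst_poly_superset:
  assumes "finite T" "Poly_Mapping.keys p \<subseteq> T"
  shows "subst_poly s p = (\<Sum>t\<in>T. const_poly (Poly_Mapping.lookup p t) * monom_value s t)"
  unfolding subst_poly_def monom_value_def[symmetric]
  using assms by (intro sum.mono_neutral_left) (auto simp: in_keys_iff)

lemma subst_poly_add: "subst_poly s (p + r) = subst_poly s p + subst_poly s r"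
proof -
  let ?T = "Poly_Mapping.keys p \<union> Poly_Mapping.keys r"
  have "subst_poly s w = (\<Sum>t\<in>?T. const_poly (Poly_Mapping.lookup w t) * monom_value s t)"
    if "Poly_Mapping.keys w \<subseteq> ?T" for w
    using that by (intro subst_poly_superset) auto
  then show ?thesis
    using keys_add[of p r] by (simp add: lookup_add const_poly.hom_add distrib_right sum.distrib)
qed

lemma subst_poly_0 [simp]: "subst_poly s 0 = 0"
  by (simp add: subst_poly_def)

lemma subst_poly_sum: "subst_poly s (sum f A) = (\<Sum>i\<in>A. subst_poly s (f i))"
  by (induction A rule: infinite_finite_induct) (simp_all add: subst_poly_add)

lemma subst_poly_single:
  "subst_poly s (Poly_Mapping.single t c) = const_poly c * monom_value s t"
  by (subst subst_poly_superset[of "{t}"]) auto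

lemma mvpoly_sum_singles:
  "(p :: 'a::field mvpoly) = (\<Sum>t\<in>Poly_Mapping.keys p. Poly_Mapping.single t (Poly_Mapping.lookup p t))"
  by (rule poly_mapping_eqI)
    (auto simp: lookup_sum lookup_single when_def in_keys_iff)

lemma subst_poly_mult: "subst_poly s (p * r) = subst_poly s p * subst_poly s r"
proof -
  have "p * r = (\<Sum>t\<in>Poly_Mapping.keys p. \<Sum>u\<in>Poly_Mapping.keys r.
      Poly_Mapping.single (t + u) (Poly_Mapping.lookup p t * Poly_Mapping.lookup r u))"
    by (subst mvpoly_sum_singles[of p], subst mvpoly_sum_singles[of r])
      (simp add: sum_product mult_single)
  then show ?thesis
    by (simp add: subst_poly_sum subst_poly_single monom_value_add const_poly.hom_mult
        subst_poly_def[of s p] subst_poly_def[of s r] monom_value_def[symmetric] sum_product mult_ac)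
qed

lemma subst_poly_const [simp]: "subst_poly s (const_poly c) = const_poly c"
  by (simp add: const_poly_def subst_poly_single)

lemma subst_poly_var [simp]: "subst_poly s (var_poly v) = s v"
  by (simp add: var_poly_def subst_poly_single monom_value_def)

interpretation subst_poly: comm_ring_hom "subst_poly s"
  by unfold_locales
    (use subst_poly_const[of s 1] in \<open>simp_all add: subst_poly_add subst_poly_mult const_poly.hom_one\<close>)

lemma mvpoly_expansion: "p = subst_poly var_poly (p :: 'a::field mvpoly)"
proof -
  have "(\<Prod>v\<in>V. var_poly v ^ k v) = (Poly_Mapping.single (\<Sum>v\<in>V. Poly_Mapping.single v (k v)) 1 :: 'a mvpoly)"
    for V :: "(nat \<times> nat) set" and k
  proof (induction V rule: infinite_finite_induct)
    case (insert v V)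
    have "var_poly v ^ l = (Poly_Mapping.single (Poly_Mapping.single v l) 1 :: 'a mvpoly)" for l
      by (induction l) (simp_all add: var_poly_def mult_single single_add[symmetric])
    then show ?case using insert by (simp add: mult_single)
  qed simp_all
  moreover have "t = (\<Sum>v\<in>Poly_Mapping.keys t. Poly_Mapping.single v (Poly_Mapping.lookup t v))"
    for t :: "nat \<times> nat \<Rightarrow>\<^sub>0 nat"
    by (rule poly_mapping_eqI) (auto simp: lookup_sum lookup_single when_def in_keys_iff)
  ultimately have "monom_value var_poly t = (Poly_Mapping.single t 1 :: 'a mvpoly)" for t
    by (metis monom_value_def)
  then have "subst_poly var_poly p = (\<Sum>t\<in>Poly_Mapping.keys p. Poly_Mapping.single t (Poly_Mapping.lookup p t))"
    by (simp add: subst_poly_def monom_value_def[symmetric]) (simp add: const_poly_def mult_single)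
  then show ?thesis using mvpoly_sum_singles by metis
qed

lemma poly_mW_add: "p \<in> poly_mW m n \<Longrightarrow> r \<in> poly_mW m n \<Longrightarrow> p + r \<in> poly_mW m n"
  using keys_add[of p r] by (auto simp: poly_mW_def)

lemma poly_mW_mult:
  assumes "p \<in> poly_mW m n" "r \<in> poly_mW m n"
  shows "p * r \<in> poly_mW m n"
  unfolding poly_mW_def
proof (intro CollectI ballI)
  fix t assume "t \<in> Poly_Mapping.keys (p * r)"
  then obtain u v where "t = u + v" "u \<in> Poly_Mapping.keys p" "v \<in> Poly_Mapping.keys r"
    using keys_mult[of p r] by blast
  then show "Poly_Mapping.keys t \<subseteq> {..<m} \<times> {..<n}"
    using keys_add[of u v] assms by (force simp: poly_mW_def)
qed

lemma poly_mW_const: "const_poly c \<in> poly_mW m n"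
  by (simp add: poly_mW_def const_poly_def)

lemma poly_mW_var: "i < m \<Longrightarrow> j < n \<Longrightarrow> var_poly (i, j) \<in> poly_mW m n"
  by (simp add: poly_mW_def var_poly_def)

lemma poly_mW_0: "0 \<in> poly_mW m n" and poly_mW_1: "1 \<in> poly_mW m n"
  by (simp_all add: poly_mW_def)

lemma poly_mW_uminus: "p \<in> poly_mW m n \<Longrightarrow> - p \<in> poly_mW m n"
  by (simp add: poly_mW_def)

lemma poly_mW_sum: "(\<And>i. i \<in> A \<Longrightarrow> f i \<in> poly_mW m n) \<Longrightarrow> sum f A \<in> poly_mW m n"
  by (induction A rule: infinite_finite_induct) (auto intro: poly_mW_0 poly_mW_add)

lemma poly_mW_prod: "(\<And>i. i \<in> A \<Longrightarrow> f i \<in> poly_mW m n) \<Longrightarrow> prod f A \<in> poly_mW m n"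
  by (induction A rule: infinite_finite_induct) (auto intro: poly_mW_1 poly_mW_mult)

lemma poly_mW_power: "p \<in> poly_mW m n \<Longrightarrow> p ^ k \<in> poly_mW m n"
  by (induction k) (auto intro: poly_mW_1 poly_mW_mult)

lemma poly_mW_det:
  assumes "\<And>i j. i < dim_row A \<Longrightarrow> j < dim_col A \<Longrightarrow> A $$ (i, j) \<in> poly_mW m n"
  shows "det A \<in> poly_mW m n"
proof (cases "dim_row A = dim_col A")
  case True
  have "signof p \<in> poly_mW m n" for p :: "nat \<Rightarrow> nat"
    by (auto simp: sign_def intro: poly_mW_1 poly_mW_uminus)
  then show ?thesis
    unfolding det_def using True
    by (auto intro!: poly_mW_sum poly_mW_mult poly_mW_prod assms simp: permutes_in_image)
qed (simp add: det_def poly_mW_0)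

lemma subst_poly_mem:
  assumes "p \<in> poly_mW m n"
    and "\<And>c. P (const_poly c)" "\<And>p r. P p \<Longrightarrow> P r \<Longrightarrow> P (p + r)" "\<And>p r. P p \<Longrightarrow> P r \<Longrightarrow> P (p * r)"
    and s: "\<And>i j. i < m \<Longrightarrow> j < n \<Longrightarrow> P (s (i, j))"
  shows "P (subst_poly s p)"
proof -
  have 0: "P 0" and 1: "P 1"
    using assms(2)[of 0] assms(2)[of 1] by (simp_all add: const_poly.hom_zero const_poly.hom_one)
  have sum: "P (sum f A)" if "\<And>i. i \<in> A \<Longrightarrow> P (f i)" for f and A :: "(nat \<times> nat \<Rightarrow>\<^sub>0 nat) set"
    using that by (induction A rule: infinite_finite_induct) (auto intro: assms 0)
  have prod: "P (prod f A)" if "\<And>i. i \<in> A \<Longrightarrow> P (f i)" for f and A :: "(nat \<times> nat) set"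
    using that by (induction A rule: infinite_finite_induct) (auto intro: assms 1)
  have pow: "P (r ^ k)" if "P r" for r k
    using that by (induction k) (auto intro: assms 1)
  show ?thesis
    unfolding subst_poly_def
    using assms(1) by (intro sum assms prod pow) (auto simp: poly_mW_def intro!: s)
qed

text \<open>
The ring of polynomial functions is generated by constants and variables: a polynomial is the result of
substituting the variables for themselves.
\<close>

lemma poly_mW_induct [consumes 1, case_names const var add mult]:
  assumes "p \<in> poly_mW m n"
    and "\<And>c. P (const_poly c)" "\<And>i j. i < m \<Longrightarrow> j < n \<Longrightarrow> P (var_poly (i, j))"
    and "\<And>p r. P p \<Longrightarrow> P r \<Longrightarrow> P (p + r)" "\<And>p r. P p \<Longrightarrow> P r \<Longrightarrow> P (p * r)"
  shows "P p"
  using subst_poly_mem[of p m n P var_poly] assms mvpoly_expansion[of p] by metis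

section \<open>Descent\<close>

text \<open>
The action on fractions is a meaningful map only on the fractions of polynomial functions on \<open>mW\<close>, so its laws
are stated on a subset \<open>D\<close> of the field.
\<close>

locale subfield_endomorphism = subfield_set D for D :: "'b::field set" +
  fixes \<sigma> :: "'b \<Rightarrow> 'b"
  assumes endo_one: "\<sigma> 1 = 1"
    and endo_add: "a \<in> D \<Longrightarrow> b \<in> D \<Longrightarrow> \<sigma> (a + b) = \<sigma> a + \<sigma> b"
    and endo_mult: "a \<in> D \<Longrightarrow> b \<in> D \<Longrightarrow> \<sigma> (a * b) = \<sigma> a * \<sigma> b"
begin

lemma endo_zero: "\<sigma> 0 = 0"
  using endo_add[OF zero_mem zero_mem] by (metis add.right_neutral add_left_cancel)

lemma endo_uminus: "a \<in> D \<Longrightarrow> \<sigma> (- a) = - \<sigma> a"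
  using endo_add[of a "- a"] uminus_mem endo_zero by (simp add: eq_neg_iff_add_eq_0 add.commute)

lemma endo_inverse:
  assumes "a \<in> D" "a \<noteq> 0"
  shows "\<sigma> (inverse a) = inverse (\<sigma> a)"
  using endo_mult[OF assms(1) inverse_mem[OF assms]] assms endo_one
  by (metis inverse_unique right_inverse)

lemma endo_sum: "(\<And>i. i \<in> A \<Longrightarrow> f i \<in> D) \<Longrightarrow> \<sigma> (sum f A) = (\<Sum>i\<in>A. \<sigma> (f i))"
  by (induction A rule: infinite_finite_induct) (auto simp: endo_zero endo_add sum_mem)

lemma subfield_set_fixed: "subfield_set {a \<in> D. \<sigma> a = a}"
  by unfold_locales
    (auto simp: one_mem add_mem mult_mem uminus_mem inverse_mem
      endo_one endo_add endo_mult endo_uminus endo_inverse)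

lemma endo_poly:
  assumes "\<And>i. coeff P i \<in> D \<and> \<sigma> (coeff P i) = coeff P i" "y \<in> D"
  shows "\<sigma> (poly P y) = poly P (\<sigma> y) \<and> poly P y \<in> D"
  using assms(1)
proof (induction P)
  case (pCons a P)
  have "a \<in> D \<and> \<sigma> a = a" using pCons.prems[of 0] by simp
  moreover have "coeff P i \<in> D \<and> \<sigma> (coeff P i) = coeff P i" for i
    using pCons.prems[of "Suc i"] by simp
  ultimately show ?case
    using pCons.IH \<open>y \<in> D\<close> by (simp add: endo_add endo_mult mult_mem add_mem)
qed (simp add: endo_zero zero_mem)

end

context independent_family
begin

text \<open>
The variables \<open>x (n - 1), \<dots>, x 0\<close> are removed one after the other from the field that contains \<open>f\<close>. In
each step \<open>S\<close> is the set of coefficient vectors of points at which \<open>f\<close> is the quotient of the same two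
polynomials \<open>P\<close> and \<open>Q\<close>. It contains the unit vector of \<open>x j\<close>. It is closed under the substitutions
for \<open>x l\<close> with \<open>l \<ge> j\<close>, since these fix \<open>f\<close> and the coefficients of \<open>P\<close> and \<open>Q\<close>.
\<close>

lemma mem_base_field_if_fixed:
  fixes allowed :: "'a \<Rightarrow> bool" and H :: "'b set"
  defines "K \<equiv> gen_field (range \<iota> \<union> H)"
  assumes f: "f \<in> gen_field (range \<iota> \<union> H \<union> x ` {..<n})"
    and coeffs: "\<And>k. k < n \<Longrightarrow> moore_coeff (\<lambda>j. x j ^ q ^ n) k \<in> K"
    and allowed_1: "allowed 1"
    and last: "(\<forall>c. c \<noteq> 0 \<longrightarrow> allowed c) \<or> det (moore n) \<in> K"
    and D: "subfield_set D" "range \<iota> \<union> H \<union> x ` {..<n} \<subseteq> D"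
    and fixed: "\<And>l r. l < n \<Longrightarrow> allowed (r l) \<Longrightarrow> \<exists>\<sigma>. subfield_endomorphism D \<sigma> \<and>
      (\<forall>c \<in> range \<iota> \<union> H. \<sigma> c = c) \<and> \<sigma> f = f \<and>
      (\<forall>i<n. i \<noteq> l \<longrightarrow> \<sigma> (x i) = x i) \<and> \<sigma> (x l) = comb n r"
  shows "f \<in> K"
proof -
  define F where "F j = gen_field (range \<iota> \<union> H \<union> x ` {..<j})" for j
  have F_subfield: "subfield_set (F j)" for j
    unfolding F_def by (rule subfield_set_gen_field)
  have F_incl: "range \<iota> \<union> H \<union> x ` {..<j} \<subseteq> F j" for j
    unfolding F_def by (auto intro: generate_field.incl)
  have K_F: "K \<subseteq> F j" for j
    unfolding K_def F_def by (intro gen_field_mono) auto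
  interpret D: subfield_set D by fact
  have F_D: "F j \<subseteq> D" if "j \<le> n" for j
    unfolding F_def using D that by (intro gen_field_subset) (auto simp: subset_iff)
  have comb_D: "comb n a \<in> D" for a
    unfolding comb_def using D(2) by (intro D.sum_mem D.mult_mem) auto
  have f_D: "f \<in> D" using f F_D[of n] by (auto simp: F_def)
  have step: "f \<in> F j" if j: "j < n" and f: "f \<in> F (Suc j)" for j
  proof -
    interpret F: subfield_set "F j" by (rule F_subfield)
    have "range \<iota> \<union> H \<union> x ` {..<Suc j} = insert (x j) (range \<iota> \<union> H \<union> x ` {..<j})"
      by (auto simp: lessThan_Suc)
    then obtain P Q where PQ: "F.coeffs_in P" "F.coeffs_in Q" "poly Q (x j) \<noteq> 0"
        "f * poly Q (x j) = poly P (x j)"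
      using gen_field_insert_quotient[of f "x j" "range \<iota> \<union> H \<union> x ` {..<j}"] f
      unfolding F_def by metis
    define S where "S = {a. f * poly Q (comb n a) = poly P (comb n a)}"
    have start: "(\<lambda>i. if i = j then 1 else 0) \<in> S"
      using PQ comb_unit[OF j] by (simp add: S_def)
    have closed: "(\<lambda>k. (if k = l then 0 else a k) + a l * r k) \<in> S"
      if a: "a \<in> S" and l: "j \<le> l" "l < n" "allowed (r l)" for a l r
    proof -
      obtain \<sigma> where \<sigma>: "subfield_endomorphism D \<sigma>" "\<forall>c \<in> range \<iota> \<union> H. \<sigma> c = c" "\<sigma> f = f"
          "\<forall>i<n. i \<noteq> l \<longrightarrow> \<sigma> (x i) = x i" "\<sigma> (x l) = comb n r"
        using fixed l by blast
      interpret subfield_endomorphism D \<sigma> by fact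
      have "F j \<subseteq> {a \<in> D. \<sigma> a = a}"
        unfolding F_def using D(2) \<sigma> l j
        by (intro gen_field_subset subfield_set_fixed) auto
      then have P: "\<sigma> (poly P y) = poly P (\<sigma> y)" "poly P y \<in> D"
        and Q: "\<sigma> (poly Q y) = poly Q (\<sigma> y)" "poly Q y \<in> D" if "y \<in> D" for y
        using PQ endo_poly[OF _ that, of P] endo_poly[OF _ that, of Q] by (auto simp: F.coeffs_in_def)
      have mem: "\<iota> c \<in> D" "x i \<in> D" if "i < n" for c i
        using D(2) that by auto
      have "\<sigma> (comb n a) = (\<Sum>i<n. \<iota> (a i) * \<sigma> (x i))"
        unfolding comb_def using mem \<sigma>(2)
        by (subst endo_sum) (auto intro!: sum.cong D.mult_mem simp: endo_mult)
      also have "\<dots> = (\<Sum>i<n. \<iota> (if i = l then 0 else a i) * x i) + \<iota> (a l) * comb n r"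
      proof -
        have "(\<Sum>i<n. \<iota> (a i) * \<sigma> (x i))
            = (\<Sum>i<n. \<iota> (if i = l then 0 else a i) * x i + (if i = l then \<iota> (a l) * comb n r else 0))"
          using \<sigma> by (intro sum.cong) auto
        then show ?thesis unfolding sum.distrib using l by simp
      qed
      also have "\<dots> = comb n (\<lambda>k. (if k = l then 0 else a k) + a l * r k)"
        by (simp add: comb_def hom_add hom_mult sum_distrib_left distrib_right sum.distrib mult.assoc)
      finally show ?thesis
        using a P(1)[OF comb_D] Q[OF comb_D] endo_mult[OF f_D Q(2)[OF comb_D]] \<sigma>(3)
        unfolding S_def mem_Collect_eq by metis
    qed
    show ?thesis
    proof (cases "Suc j < n \<or> (\<forall>c. c \<noteq> 0 \<longrightarrow> allowed c)")
      case True
      show ?thesis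
      proof (rule mem_subfield_if_constant_off_span[OF F_subfield _ j _ _ PQ(1,2)])
        fix a assume a: "comb n a \<notin> range (comb j)"
        have "\<exists>k. j \<le> k \<and> k < n \<and> a k \<noteq> 0"
        proof (rule ccontr)
          assume "\<not> ?thesis"
          then have "comb n a = comb n (\<lambda>i. if i < j then a i else 0)"
            by (intro comb_cong) auto
          then show False using a comb_padded[of j n a] j by simp
        qed
        then have "a \<in> S"
          using elementary_reachable_nonzero[OF start closed j allowed_1 True] by blast
        then show "f * poly Q (comb n a) = poly P (comb n a)" by (simp add: S_def)
      qed (use F_incl[of j] K_F[of j] coeffs PQ in auto)
    next
      case False
      then have n: "n = Suc j" using j by simp
      show ?thesis
      proof (rule mem_subfield_if_constant_on_coset[OF F_subfield _ n _ _ PQ(1,2)])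
        fix a :: "nat \<Rightarrow> 'a"
        define a' where "a' = (\<lambda>i. if i < j then a i else 1)"
        have "a' \<in> S"
          using elementary_reachable_allowed[where S = S and j = j and n = n and allowed = allowed, OF start closed j]
            allowed_1 by (simp add: a'_def)
        moreover have "comb n a' = x j + comb j a"
          by (simp add: comb_def n a'_def add.commute)
        ultimately show "f * poly Q (x j + comb j a) = poly P (x j + comb j a)" by (simp add: S_def)
      qed (use F_incl[of j] K_F[of j] last False PQ in auto)
    qed
  qed
  have "f \<in> F 0"
    by (rule inc_induct[of 0 n "\<lambda>j. f \<in> F j"]) (use f step in \<open>auto simp: F_def\<close>)
  then show ?thesis by (simp add: F_def K_def)
qed

end

section \<open>Linear substitutions\<close>

definition lin_subst :: "nat \<Rightarrow> (nat \<Rightarrow> nat \<Rightarrow> 'a) \<Rightarrow> 'a::field mvpoly \<Rightarrow> 'a mvpoly" where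
  "lin_subst n A = subst_poly (\<lambda>(i, j). \<Sum>k<n. const_poly (A j k) * var_poly (i, k))"

interpretation lin_subst: comm_ring_hom "lin_subst n A"
  unfolding lin_subst_def by (rule subst_poly.comm_ring_hom_axioms)

lemma lin_subst_const [simp]: "lin_subst n A (const_poly c) = const_poly c"
  by (simp add: lin_subst_def)

lemma lin_subst_var: "lin_subst n A (var_poly (i, j)) = (\<Sum>k<n. const_poly (A j k) * var_poly (i, k))"
  by (simp add: lin_subst_def)

lemma lin_subst_inverse:
  assumes "p \<in> poly_mW m n"
    and BA: "\<And>j l. j < n \<Longrightarrow> l < n \<Longrightarrow> (\<Sum>k<n. B j k * A k l) = (if j = l then 1 else 0)"
  shows "lin_subst n A (lin_subst n B p) = p"
  using assms(1)
proof (induction rule: poly_mW_induct)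
  case (var i j)
  have "lin_subst n A (lin_subst n B (var_poly (i, j)))
      = (\<Sum>k<n. \<Sum>l<n. const_poly (B j k * A k l) * var_poly (i, l))"
    by (simp add: lin_subst_var lin_subst.hom_sum lin_subst.hom_mult const_poly.hom_mult
        sum_distrib_left mult.assoc)
  also have "\<dots> = (\<Sum>l<n. const_poly (\<Sum>k<n. B j k * A k l) * var_poly (i, l))"
    by (subst sum.swap) (simp add: const_poly.hom_sum sum_distrib_right)
  also have "\<dots> = (\<Sum>l<n. if l = j then var_poly (i, l) else 0)"
    using var BA by (intro sum.cong) (auto simp: const_poly.hom_zero const_poly.hom_one)
  finally show ?case using var by simp
qed (simp_all add: lin_subst.hom_add lin_subst.hom_mult)

text \<open>
If all columns of \<open>M\<close> transform like a vector of coordinates, then the substitution multiplies \<open>M\<close> from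
the left by the matrix \<open>A\<close>, and hence its determinant by \<open>det A\<close>.
\<close>

lemma lin_subst_det:
  assumes M: "M \<in> carrier_mat n n"
    and equivariant: "\<And>j r. j < n \<Longrightarrow> r < n \<Longrightarrow>
      lin_subst n A (M $$ (j, r)) = (\<Sum>k<n. const_poly (A j k) * M $$ (k, r))"
  shows "lin_subst n A (det M) = const_poly (det (mat n n (\<lambda>(j, k). A j k))) * det M"
proof -
  let ?A = "mat n n (\<lambda>(j, k). A j k)"
  have "map_mat (lin_subst n A) M = map_mat const_poly ?A * M"
    using M by (intro eq_matI) (auto simp: equivariant scalar_prod_def lessThan_atLeast0)
  then have "lin_subst n A (det M) = det (map_mat const_poly ?A * M)"
    by (metis lin_subst.hom_det)
  also have "\<dots> = det (map_mat const_poly ?A) * det M"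
    using M by (intro det_mult) auto
  finally show ?thesis by (simp add: const_poly.hom_det)
qed

section \<open>Homogeneous polynomials\<close>

definition homogeneous_of_degree :: "nat \<Rightarrow> 'a::field mvpoly \<Rightarrow> bool" where
  "homogeneous_of_degree d p \<longleftrightarrow> (\<forall>t\<in>Poly_Mapping.keys p. total_degree_monom t = d)"

lemma total_degree_monom_add: "total_degree_monom (t + u) = total_degree_monom t + total_degree_monom u"
proof -
  let ?V = "Poly_Mapping.keys t \<union> Poly_Mapping.keys u"
  have "total_degree_monom w = (\<Sum>v\<in>?V. Poly_Mapping.lookup w v)"
    if "Poly_Mapping.keys w \<subseteq> ?V" for w
    unfolding total_degree_monom_def
    using that by (intro sum.mono_neutral_left) (auto simp: in_keys_iff)
  then show ?thesis
    using keys_add[of t u] by (simp add: lookup_add sum.distrib)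
qed

lemma homogeneous_0: "homogeneous_of_degree d 0"
  by (simp add: homogeneous_of_degree_def)

lemma homogeneous_1: "homogeneous_of_degree 0 1"
  by (simp add: homogeneous_of_degree_def total_degree_monom_def)

lemma homogeneous_var: "homogeneous_of_degree 1 (var_poly v)"
  by (simp add: homogeneous_of_degree_def var_poly_def total_degree_monom_def)

lemma homogeneous_uminus: "homogeneous_of_degree d p \<Longrightarrow> homogeneous_of_degree d (- p)"
  by (simp add: homogeneous_of_degree_def)

lemma homogeneous_add:
  "homogeneous_of_degree d p \<Longrightarrow> homogeneous_of_degree d r \<Longrightarrow> homogeneous_of_degree d (p + r)"
  using keys_add[of p r] by (auto simp: homogeneous_of_degree_def)

lemma homogeneous_mult:
  "homogeneous_of_degree d p \<Longrightarrow> homogeneous_of_degree e r \<Longrightarrow> homogeneous_of_degree (d + e) (p * r)"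
  using keys_mult[of p r] by (fastforce simp: homogeneous_of_degree_def total_degree_monom_add)

lemma homogeneous_power: "homogeneous_of_degree d p \<Longrightarrow> homogeneous_of_degree (k * d) (p ^ k)"
  by (induction k) (auto intro: homogeneous_1 homogeneous_mult)

lemma homogeneous_sum:
  "(\<And>i. i \<in> A \<Longrightarrow> homogeneous_of_degree d (f i)) \<Longrightarrow> homogeneous_of_degree d (sum f A)"
  by (induction A rule: infinite_finite_induct) (auto intro: homogeneous_0 homogeneous_add)

lemma homogeneous_prod:
  "finite A \<Longrightarrow> (\<And>i. i \<in> A \<Longrightarrow> homogeneous_of_degree (d i) (f i)) \<Longrightarrow>
    homogeneous_of_degree (\<Sum>i\<in>A. d i) (prod f A)"
  by (induction A rule: finite_induct) (auto intro: homogeneous_1 homogeneous_mult)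

lemma homogeneous_det:
  assumes M: "M \<in> carrier_mat n n"
    and d: "\<And>j r. j < n \<Longrightarrow> r < n \<Longrightarrow> homogeneous_of_degree (d r) (M $$ (j, r))"
  shows "homogeneous_of_degree (\<Sum>r<n. d r) (det M)"
  unfolding det_def'[OF M]
proof (rule homogeneous_sum)
  fix p assume "p \<in> {p. p permutes {0..<n}}"
  then have p: "p permutes {0..<n}" by simp
  have "homogeneous_of_degree (\<Sum>i\<in>{0..<n}. d (p i)) (\<Prod>i\<in>{0..<n}. M $$ (i, p i))"
    using permutes_in_image[OF p] by (intro homogeneous_prod d) auto
  also have "(\<Sum>i\<in>{0..<n}. d (p i)) = (\<Sum>r<n. d r)"
    using sum.permute[OF p, of d] by (simp add: lessThan_atLeast0 o_def)
  finally show "homogeneous_of_degree (\<Sum>r<n. d r) (signof p * (\<Prod>i = 0..<n. M $$ (i, p i)))"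
    by (auto simp: sign_def intro: homogeneous_uminus)
qed

section \<open>The action on fractions\<close>

lemma subfield_set_frac_mW: "subfield_set (frac_mW m n :: 'a::field mvpoly fract set)"
proof
  have I: "Fract p r \<in> frac_mW m n" if "p \<in> poly_mW m n" "r \<in> poly_mW m n" "r \<noteq> 0" for p r :: "'a mvpoly"
    using that by (auto simp: frac_mW_def)
  show "(1 :: 'a mvpoly fract) \<in> frac_mW m n"
    unfolding One_fract_def by (intro I poly_mW_1) simp
  fix a :: "'a mvpoly fract" assume "a \<in> frac_mW m n"
  then obtain p r where a: "a = Fract p r" "p \<in> poly_mW m n" "r \<in> poly_mW m n" "r \<noteq> 0"
    by (auto simp: frac_mW_def)
  show "- a \<in> frac_mW m n"
    using a by (auto intro!: I poly_mW_uminus)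
  show "inverse a \<in> frac_mW m n" if "a \<noteq> 0"
    using a that by (auto intro!: I simp: Zero_fract_def eq_fract)
  fix b :: "'a mvpoly fract" assume "b \<in> frac_mW m n"
  then obtain p' r' where b: "b = Fract p' r'" "p' \<in> poly_mW m n" "r' \<in> poly_mW m n" "r' \<noteq> 0"
    by (auto simp: frac_mW_def)
  show "a + b \<in> frac_mW m n" "a * b \<in> frac_mW m n"
    using a b by (auto intro!: I poly_mW_add poly_mW_mult)
qed

lemma to_fract_mem_frac_mW: "p \<in> poly_mW m n \<Longrightarrow> to_fract p \<in> frac_mW m n"
  unfolding to_fract_def frac_mW_def using poly_mW_1 zero_neq_one by fastforce

interpretation to_fract: comm_ring_hom "to_fract :: 'a::idom \<Rightarrow> 'a fract"
  by unfold_locales simp_all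

text \<open>
Injectivity on polynomial functions keeps denominators nonzero, so the value does not depend on
the chosen numerator and denominator.
\<close>

lemma act_frac_Fract:
  assumes act: "act_poly scale n b g = lin_subst n A"
    and inj: "\<And>p. p \<in> poly_mW m n \<Longrightarrow> lin_subst n A p = 0 \<Longrightarrow> p = 0"
    and p: "p \<in> poly_mW m n" "r \<in> poly_mW m n" "r \<noteq> 0"
  shows "act_frac scale m n b g (Fract p r) = Fract (lin_subst n A p) (lin_subst n A r)"
  unfolding act_frac_def act
proof (rule the_equality)
  fix y
  assume "\<exists>p'\<in>poly_mW m n. \<exists>r'\<in>poly_mW m n. r' \<noteq> 0 \<and> Fract p r = Fract p' r' \<and>
    y = Fract (lin_subst n A p') (lin_subst n A r')"
  then obtain p' r' where *: "p' \<in> poly_mW m n" "r' \<in> poly_mW m n" "r' \<noteq> 0"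
      "Fract p r = Fract p' r'" "y = Fract (lin_subst n A p') (lin_subst n A r')"
    by blast
  then have "lin_subst n A (p * r') = lin_subst n A (p' * r)"
    using p by (simp add: eq_fract)
  moreover have "lin_subst n A r \<noteq> 0" "lin_subst n A r' \<noteq> 0"
    using * p inj by auto
  ultimately show "y = Fract (lin_subst n A p) (lin_subst n A r)"
    using * by (simp add: eq_fract lin_subst.hom_mult)
qed (use p in blast)

lemma act_frac_to_fract:
  assumes "act_poly scale n b g = lin_subst n A"
    and "\<And>p. p \<in> poly_mW m n \<Longrightarrow> lin_subst n A p = 0 \<Longrightarrow> p = 0"
    and "p \<in> poly_mW m n"
  shows "act_frac scale m n b g (to_fract p) = to_fract (lin_subst n A p)"
  unfolding to_fract_def
  using act_frac_Fract[OF assms(1,2,3) poly_mW_1] by simp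

lemma subfield_endomorphism_act_frac:
  assumes act: "act_poly scale n b g = lin_subst n A"
    and inj: "\<And>p. p \<in> poly_mW m n \<Longrightarrow> lin_subst n A p = 0 \<Longrightarrow> p = 0"
  shows "subfield_endomorphism (frac_mW m n) (act_frac scale m n b g)"
proof -
  interpret subfield_set "frac_mW m n :: 'a mvpoly fract set" by (rule subfield_set_frac_mW)
  note F = act_frac_Fract[OF act inj]
  show ?thesis
  proof
    show "act_frac scale m n b g 1 = 1"
      unfolding One_fract_def by (subst F) (auto intro: poly_mW_1)
    fix u v :: "'a mvpoly fract" assume "u \<in> frac_mW m n" "v \<in> frac_mW m n"
    then obtain p r p' r' where u: "u = Fract p r" "p \<in> poly_mW m n" "r \<in> poly_mW m n" "r \<noteq> 0"
      and v: "v = Fract p' r'" "p' \<in> poly_mW m n" "r' \<in> poly_mW m n" "r' \<noteq> 0"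
      by (auto simp: frac_mW_def)
    have "lin_subst n A r \<noteq> 0" "lin_subst n A r' \<noteq> 0"
      using u v inj by auto
    then show "act_frac scale m n b g (u + v) = act_frac scale m n b g u + act_frac scale m n b g v"
      "act_frac scale m n b g (u * v) = act_frac scale m n b g u * act_frac scale m n b g v"
      using u v by (simp_all add: F poly_mW_add poly_mW_mult lin_subst.hom_add lin_subst.hom_mult)
  qed
qed

section \<open>Coordinates and matrices of group elements\<close>

definition matrices_inverse :: "nat \<Rightarrow> (nat \<Rightarrow> nat \<Rightarrow> 'a::field) \<Rightarrow> (nat \<Rightarrow> nat \<Rightarrow> 'a) \<Rightarrow> bool" where
  "matrices_inverse n A B \<longleftrightarrow>
    (\<forall>j<n. \<forall>l<n. (\<Sum>k<n. A j k * B k l) = (if j = l then 1 else 0))"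

lemma matrices_inverse_iff:
  "matrices_inverse n A B \<longleftrightarrow> mat n n (\<lambda>(i, j). A i j) * mat n n (\<lambda>(i, j). B i j) = 1\<^sub>m n"
proof -
  have "(mat n n (\<lambda>(i, j). A i j) * mat n n (\<lambda>(i, j). B i j)) $$ (j, l) = (\<Sum>k<n. A j k * B k l)"
    if "j < n" "l < n" for j l
    using that by (simp add: scalar_prod_def lessThan_atLeast0)
  then show ?thesis
    unfolding matrices_inverse_def mat_eq_iff by auto
qed

lemma matrices_inverse_commute: "matrices_inverse n A B \<Longrightarrow> matrices_inverse n B A"
  unfolding matrices_inverse_iff by (rule mat_mult_left_right_inverse[of _ n]) auto

text \<open>
The matrix of the substitution \<open>x l \<mapsto> \<Sum>k<n. r k * x k\<close> that fixes all other variables.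
\<close>

definition row_replacement :: "nat \<Rightarrow> (nat \<Rightarrow> 'a::field) \<Rightarrow> nat \<Rightarrow> nat \<Rightarrow> 'a" where
  "row_replacement l r j k = (if j = l then r k else if j = k then 1 else 0)"

text \<open>
Cramer's rule for the identity matrix, whose solution vector is the right-hand side.
\<close>

lemma det_row_replacement:
  assumes "l < n"
  shows "det (mat n n (\<lambda>(j, k). row_replacement l r j k)) = r l"
proof -
  have "transpose_mat (mat n n (\<lambda>(j, k). row_replacement l r j k)) = replace_col (1\<^sub>m n) (1\<^sub>m n *\<^sub>v vec n r) l"
    by (intro eq_matI) (auto simp: replace_col_def row_replacement_def)
  then have "det (mat n n (\<lambda>(j, k). row_replacement l r j k)) = det (replace_col (1\<^sub>m n) (1\<^sub>m n *\<^sub>v vec n r) l)"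
    using det_transpose[of "mat n n (\<lambda>(j, k). row_replacement l r j k)" n] by simp
  also have "\<dots> = r l"
    using cramer_lemma_mat[of "1\<^sub>m n" n "vec n r" l] assms by simp
  finally show ?thesis .
qed

lemma row_replacement_inverse:
  assumes "l < n" "r l \<noteq> 0"
  shows "matrices_inverse n (row_replacement l r)
    (row_replacement l (\<lambda>k. if k = l then 1 / r l else - r k / r l))"
  unfolding matrices_inverse_def
proof (intro allI impI)
  fix j m assume jm: "j < n" "m < n"
  let ?s = "\<lambda>k. if k = l then 1 / r l else - r k / r l"
  show "(\<Sum>k<n. row_replacement l r j k * row_replacement l ?s k m) = (if j = m then 1 else 0)"
  proof (cases "j = l")
    case False
    have "(\<Sum>k<n. row_replacement l r j k * row_replacement l ?s k m)
        = (\<Sum>k<n. if k = j then row_replacement l ?s k m else 0)"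
      using False by (intro sum.cong) (auto simp: row_replacement_def)
    then show ?thesis using jm False by (simp add: row_replacement_def)
  next
    case True
    have "(\<Sum>k\<in>{..<n} - {l}. row_replacement l r j k * row_replacement l ?s k m)
        = (\<Sum>k\<in>{..<n} - {l}. if k = m then r k else 0)"
      using True by (intro sum.cong) (auto simp: row_replacement_def)
    then show ?thesis
      using assms jm True by (auto simp: sum.remove[of "{..<n}" l] row_replacement_def)
  qed
qed

locale based_space =
  fixes scale :: "'a::field \<Rightarrow> 'w::ab_group_add \<Rightarrow> 'w" and n :: nat and b :: "nat \<Rightarrow> 'w"
  assumes basis: "ordered_basis scale n b"
begin

sublocale V: finite_dimensional_vector_space scale "b ` {..<n}"
  using basis by (simp add: ordered_basis_def)

abbreviation crd :: "nat \<Rightarrow> 'w \<Rightarrow> 'a" where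
  "crd \<equiv> coord scale n b"

lemma b_inj: "i < n \<Longrightarrow> j < n \<Longrightarrow> b i = b j \<longleftrightarrow> i = j"
  using basis by (auto simp: ordered_basis_def inj_on_def)

lemma crd_basis: "j < n \<Longrightarrow> k < n \<Longrightarrow> crd j (b k) = (if j = k then 1 else 0)"
  unfolding coord_def using V.representation_basis[OF V.independent_Basis, of "b k"] b_inj by auto

lemma crd_add: "crd j (u + v) = crd j u + crd j v"
  unfolding coord_def by (simp add: V.representation_add[OF V.independent_Basis] V.span_Basis)

lemma crd_scale: "crd j (scale c u) = c * crd j u"
  unfolding coord_def by (simp add: V.representation_scale[OF V.independent_Basis] V.span_Basis)

lemma crd_zero: "crd j 0 = 0"
  unfolding coord_def by (simp add: V.representation_zero)

lemma crd_sum: "crd j (\<Sum>i\<in>I. f i) = (\<Sum>i\<in>I. crd j (f i))"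
  by (induction I rule: infinite_finite_induct) (simp_all add: crd_add crd_zero)

lemma crd_expansion: "(\<Sum>j<n. scale (crd j w) (b j)) = w"
proof -
  have "inj_on b {..<n}" using basis by (simp add: ordered_basis_def)
  then have "(\<Sum>j<n. scale (crd j w) (b j))
      = (\<Sum>v\<in>b ` {..<n}. scale (V.representation (b ` {..<n}) w v) v)"
    by (simp add: sum.reindex coord_def)
  also have "\<dots> = w"
    by (intro V.sum_representation_eq V.independent_Basis) (simp_all add: V.span_Basis)
  finally show ?thesis .
qed

lemma crd_linear:
  assumes "Vector_Spaces.linear scale scale g"
  shows "crd j (g w) = (\<Sum>k<n. crd j (g (b k)) * crd k w)"
proof -
  interpret g: Vector_Spaces.linear scale scale g by fact
  have "g w = g (\<Sum>k<n. scale (crd k w) (b k))" by (simp add: crd_expansion)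
  also have "\<dots> = (\<Sum>k<n. scale (crd k w) (g (b k)))" by (simp add: g.sum g.scale)
  finally show ?thesis by (simp add: crd_sum crd_scale mult.commute)
qed

definition linear_of_matrix :: "(nat \<Rightarrow> nat \<Rightarrow> 'a) \<Rightarrow> 'w \<Rightarrow> 'w" where
  "linear_of_matrix A w = (\<Sum>i<n. scale (\<Sum>k<n. A i k * crd k w) (b i))"

lemma crd_linear_of_matrix:
  assumes "j < n"
  shows "crd j (linear_of_matrix A w) = (\<Sum>k<n. A j k * crd k w)"
proof -
  have "crd j (linear_of_matrix A w) = (\<Sum>i<n. if i = j then (\<Sum>k<n. A i k * crd k w) else 0)"
    unfolding linear_of_matrix_def using assms
    by (simp add: crd_sum crd_scale crd_basis if_distrib[of "\<lambda>c. _ * c"] cong: if_cong)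
  then show ?thesis using assms by simp
qed

lemma linear_linear_of_matrix: "Vector_Spaces.linear scale scale (linear_of_matrix A)"
  unfolding Vector_Spaces.linear_iff
proof (intro conjI allI V.vector_space_axioms)
  fix u v :: 'w and c :: 'a
  show "linear_of_matrix A (u + v) = linear_of_matrix A u + linear_of_matrix A v"
    by (simp add: linear_of_matrix_def crd_add distrib_left sum.distrib V.scale_left_distrib)
  have "(\<Sum>k<n. A i k * (c * crd k u)) = c * (\<Sum>k<n. A i k * crd k u)" for i
    by (simp add: sum_distrib_left mult.left_commute)
  then show "linear_of_matrix A (scale c u) = scale c (linear_of_matrix A u)"
    by (simp add: linear_of_matrix_def crd_scale V.scale_sum_right)
qed

lemma linear_of_matrix_inverse:
  assumes "matrices_inverse n B A"
  shows "linear_of_matrix B (linear_of_matrix A w) = w"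
proof -
  have "crd j (linear_of_matrix B (linear_of_matrix A w)) = crd j w" if j: "j < n" for j
  proof -
    have "crd j (linear_of_matrix B (linear_of_matrix A w)) = (\<Sum>k<n. \<Sum>l<n. B j k * A k l * crd l w)"
      by (simp add: j crd_linear_of_matrix sum_distrib_left mult.assoc)
    also have "\<dots> = (\<Sum>l<n. (\<Sum>k<n. B j k * A k l) * crd l w)"
      by (subst sum.swap) (simp add: sum_distrib_right)
    also have "\<dots> = (\<Sum>l<n. if l = j then crd l w else 0)"
      using assms j by (intro sum.cong) (auto simp: matrices_inverse_def)
    finally show ?thesis using j by simp
  qed
  then show ?thesis using crd_expansion by (metis (no_types, lifting) lessThan_iff sum.cong)
qed

text \<open>
A group element acts on functions through its inverse, so the matrix of the inverse describes the substitution.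
\<close>

definition inverse_matrix :: "('w \<Rightarrow> 'w) \<Rightarrow> nat \<Rightarrow> nat \<Rightarrow> 'a" where
  "inverse_matrix g j k = crd j (inv_into UNIV g (b k))"

lemma act_poly_eq: "act_poly scale n b g = lin_subst n (inverse_matrix g)"
  unfolding act_poly_def lin_subst_def inverse_matrix_def by simp

lemma inverse_matrix:
  assumes "g \<in> GL_W scale"
  shows "matrices_inverse n (\<lambda>j k. crd j (g (b k))) (inverse_matrix g)"
    and "det (matrix_of scale n b g) * det (mat n n (\<lambda>(j, k). inverse_matrix g j k)) = 1"
proof -
  have g: "Vector_Spaces.linear scale scale g" "bij g"
    using assms by (auto simp: GL_W_def)
  show inv: "matrices_inverse n (\<lambda>j k. crd j (g (b k))) (inverse_matrix g)"
    unfolding matrices_inverse_def inverse_matrix_def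
    using crd_linear[OF g(1), symmetric] g(2) by (simp add: bij_is_surj surj_f_inv_f crd_basis)
  then have "matrix_of scale n b g * mat n n (\<lambda>(j, k). inverse_matrix g j k) = 1\<^sub>m n"
    by (simp add: matrices_inverse_iff matrix_of_def)
  then show "det (matrix_of scale n b g) * det (mat n n (\<lambda>(j, k). inverse_matrix g j k)) = 1"
    by (metis det_mult det_one mat_carrier matrix_of_def)
qed

text \<open>
Every row replacement with nonzero determinant occurs as the substitution of some group element. The
element is constructed from the inverse matrix, because the action goes through the inverse.
\<close>

lemma elementary_element:
  assumes "l < n" "r l \<noteq> 0"
  obtains g where "g \<in> GL_W scale" "r l = 1 \<Longrightarrow> g \<in> SL_W scale n b"
    "\<And>j k. j < n \<Longrightarrow> k < n \<Longrightarrow> inverse_matrix g j k = row_replacement l r j k"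
proof -
  define A where "A = row_replacement l r"
  obtain B where AB: "matrices_inverse n A B"
    using row_replacement_inverse[of l n r] assms unfolding A_def by blast
  define g where "g = linear_of_matrix B"
  have "linear_of_matrix A \<circ> g = id" "g \<circ> linear_of_matrix A = id"
    using linear_of_matrix_inverse[OF AB] linear_of_matrix_inverse[OF matrices_inverse_commute[OF AB]]
    by (auto simp: g_def fun_eq_iff)
  then have "bij g" and inv: "inv_into UNIV g = linear_of_matrix A"
    by (auto intro: o_bij inv_unique_comp)
  have mat: "inverse_matrix g j k = A j k" if "j < n" "k < n" for j k
  proof -
    have "inverse_matrix g j k = (\<Sum>i<n. if i = k then A j i else 0)"
      unfolding inverse_matrix_def inv using that
      by (simp add: crd_linear_of_matrix crd_basis if_distrib[of "\<lambda>c. _ * c"] cong: if_cong)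
    then show ?thesis using that by simp
  qed
  have GL: "g \<in> GL_W scale"
    using \<open>bij g\<close> linear_linear_of_matrix by (simp add: GL_W_def g_def)
  have "mat n n (\<lambda>(j, k). inverse_matrix g j k) = mat n n (\<lambda>(j, k). row_replacement l r j k)"
    by (intro eq_matI) (auto simp: mat A_def)
  then have "det (mat n n (\<lambda>(j, k). inverse_matrix g j k)) = r l"
    using det_row_replacement[OF \<open>l < n\<close>] by metis
  then have "det (matrix_of scale n b g) * r l = 1"
    using inverse_matrix(2)[OF GL] by metis
  then have "g \<in> SL_W scale n b" if "r l = 1"
    using GL that by (simp add: SL_W_def)
  then show ?thesis using that GL mat by (auto simp: A_def)
qed

end

section \<open>The generating invariants\<close>

definition moore_mat :: "nat \<Rightarrow> 'a::{field, finite} mvpoly mat" where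
  "moore_mat n = mat n n (\<lambda>(j, i). var_poly (0, j) ^ CARD('a) ^ i)"

text \<open>
The column vectors to which Cramer's rule is applied. Index \<open>0\<close> stands for the \<open>q ^ n\<close>-th power of
the first copy, since the expansion of the first copy itself is trivial.
\<close>

definition gen_column :: "nat \<Rightarrow> nat \<Rightarrow> nat \<Rightarrow> 'a::{field, finite} mvpoly" where
  "gen_column n i j = (if i = 0 then var_poly (0, j) ^ CARD('a) ^ n else var_poly (i, j))"

definition gen_det :: "nat \<Rightarrow> nat \<Rightarrow> nat \<Rightarrow> 'a::{field, finite} mvpoly" where
  "gen_det n i k = det (replace_col (moore_mat n) (vec n (gen_column n i)) k)"

text \<open>
The determinants are multiplied by a power of the Moore determinant that makes the total exponent of \<open>det g\<close>
equal to \<open>e\<close>. At position \<open>(0, 0)\<close> the determinant \<open>gen_det n 0 0\<close>, which is a power of the Moore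
determinant up to sign, gives way to \<open>det (moore_mat n) ^ e\<close>.
\<close>

definition generator :: "nat \<Rightarrow> nat \<Rightarrow> nat \<Rightarrow> nat \<Rightarrow> 'a::{field, finite} mvpoly" where
  "generator n e i k =
    (if i = 0 \<and> k = 0 then det (moore_mat n) ^ e else det (moore_mat n) ^ (e - 1) * gen_det n i k)"

lemma moore_mat_carrier [simp]: "moore_mat n \<in> carrier_mat n n"
  unfolding moore_mat_def by (rule mat_carrier)

lemma moore_mat_dim [simp]: "dim_row (moore_mat n) = n" "dim_col (moore_mat n) = n"
  by (simp_all add: moore_mat_def)

lemma replace_col_carrier [simp]: "M \<in> carrier_mat n n \<Longrightarrow> replace_col M v k \<in> carrier_mat n n"
  unfolding replace_col_def by (frule carrier_matD(1), drule carrier_matD(2), simp only: mat_carrier)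

lemma generator_mem:
  assumes "i < m"
  shows "(generator n e i k :: 'a::{field, finite} mvpoly) \<in> poly_mW m n"
proof -
  have var: "(var_poly (0, j) :: 'a mvpoly) \<in> poly_mW m n" "(var_poly (i, j) :: 'a mvpoly) \<in> poly_mW m n" if "j < n" for j
    using assms that by (simp_all add: poly_mW_var)
  have moore: "(moore_mat n $$ (j, r) :: 'a mvpoly) \<in> poly_mW m n" if "j < n" "r < n" for j r
    using that var by (simp add: moore_mat_def poly_mW_power)
  have column: "(gen_column n i j :: 'a mvpoly) \<in> poly_mW m n" if "j < n" for j
    using that var by (simp add: gen_column_def poly_mW_power)
  have "(det (moore_mat n) :: 'a mvpoly) \<in> poly_mW m n"
    by (rule poly_mW_det) (simp_all add: moore)
  moreover have "(gen_det n i k :: 'a mvpoly) \<in> poly_mW m n"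
    unfolding gen_det_def
    by (rule poly_mW_det) (simp_all add: moore column replace_col_def)
  ultimately show ?thesis by (simp add: generator_def poly_mW_mult poly_mW_power)
qed

lemma homogeneous_generator: "homogeneous_poly (generator n e i k :: 'a::{field, finite} mvpoly)"
proof -
  have var_pow: "homogeneous_of_degree l (var_poly v ^ l :: 'a mvpoly)" for v l
    using homogeneous_power[OF homogeneous_var, of l] by simp
  define d where "d = (\<Sum>r<n. CARD('a) ^ r)"
  have d: "homogeneous_of_degree d (det (moore_mat n) :: 'a mvpoly)"
    unfolding d_def
  proof (rule homogeneous_det[OF moore_mat_carrier])
    fix j r assume "j < n" "r < n"
    then show "homogeneous_of_degree (CARD('a) ^ r) (moore_mat n $$ (j, r) :: 'a mvpoly)"
      using var_pow by (simp add: moore_mat_def)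
  qed
  define c where "c = (if i = 0 then CARD('a) ^ n else 1)"
  have column: "homogeneous_of_degree c (gen_column n i j :: 'a mvpoly)" for j
    using homogeneous_var[where 'a = 'a] var_pow by (simp add: gen_column_def c_def)
  have "homogeneous_of_degree (\<Sum>r<n. if r = k then c else CARD('a) ^ r) (gen_det n i k :: 'a mvpoly)"
    unfolding gen_det_def
  proof (rule homogeneous_det[OF replace_col_carrier[OF moore_mat_carrier]])
    fix j r assume "j < n" "r < n"
    then show "homogeneous_of_degree (if r = k then c else CARD('a) ^ r)
        (replace_col (moore_mat n) (vec n (gen_column n i)) k $$ (j, r) :: 'a mvpoly)"
      using var_pow column by (simp add: replace_col_def moore_mat_def)
  qed
  then obtain d' where "homogeneous_of_degree d' (gen_det n i k :: 'a mvpoly)" ..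
  then have "homogeneous_of_degree (if i = 0 \<and> k = 0 then e * d else (e - 1) * d + d')
      (generator n e i k :: 'a mvpoly)"
    unfolding generator_def
    using homogeneous_power[OF d, of e] homogeneous_mult[OF homogeneous_power[OF d, of "e - 1"]] by simp
  then have "\<exists>d. homogeneous_of_degree d (generator n e i k :: 'a mvpoly)" ..
  then show ?thesis by (simp add: homogeneous_poly_def homogeneous_of_degree_def)
qed

interpretation mvpoly_algebra: finite_field_algebra "const_poly :: 'a::{field, finite} \<Rightarrow> 'a mvpoly" "CARD('a)"
  by unfold_locales simp

lemma lin_subst_var_power:
  fixes A :: "nat \<Rightarrow> nat \<Rightarrow> 'a::{field, finite}"
  shows "lin_subst n A (var_poly (i, j) ^ CARD('a) ^ l) =
    (\<Sum>k<n. const_poly (A j k) * var_poly (i, k) ^ CARD('a) ^ l)"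
  by (simp add: lin_subst.hom_power lin_subst_var mvpoly_algebra.frobenius_combination)

lemma lin_subst_moore_mat:
  assumes "j < n" "r < n"
  shows "lin_subst n A (moore_mat n $$ (j, r)) = (\<Sum>k<n. const_poly (A j k) * moore_mat n $$ (k, r))"
  using assms by (simp add: moore_mat_def lin_subst_var_power)

lemma lin_subst_gen_column:
  "lin_subst n A (gen_column n i j) = (\<Sum>k<n. const_poly (A j k) * gen_column n i k)"
  by (simp add: gen_column_def lin_subst_var_power lin_subst_var)

lemma lin_subst_generator:
  assumes "det (mat n n (\<lambda>(j, k). A j k)) ^ e = 1" "e > 0"
  shows "lin_subst n A (generator n e i k) = generator n e i k"
proof -
  let ?d = "const_poly (det (mat n n (\<lambda>(j, k). A j k)))"
  have L: "lin_subst n A (det (moore_mat n)) = ?d * det (moore_mat n)"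
    by (intro lin_subst_det lin_subst_moore_mat) auto
  have D: "lin_subst n A (gen_det n i k) = ?d * gen_det n i k"
    unfolding gen_det_def
  proof (intro lin_subst_det replace_col_carrier moore_mat_carrier)
    fix j r assume "j < n" "r < n"
    then show "lin_subst n A (replace_col (moore_mat n) (vec n (gen_column n i)) k $$ (j, r)) =
        (\<Sum>l<n. const_poly (A j l) * replace_col (moore_mat n) (vec n (gen_column n i)) k $$ (l, r))"
      using lin_subst_moore_mat[of j n r A] lin_subst_gen_column[of n A i j]
      by (cases "r = k") (simp_all add: replace_col_def moore_mat_def)
  qed
  have d: "?d ^ e = 1"
    unfolding const_poly.hom_power[symmetric] assms by (rule const_poly.hom_one)
  show ?thesis
  proof (cases "i = 0 \<and> k = 0")
    case True
    then show ?thesis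
      by (simp add: generator_def lin_subst.hom_power L power_mult_distrib d)
  next
    case False
    then have "lin_subst n A (generator n e i k) = (?d ^ (e - 1) * ?d) * generator n e i k"
      by (auto simp: generator_def lin_subst.hom_power lin_subst.hom_mult L D power_mult_distrib)
    also have "?d ^ (e - 1) * ?d = ?d ^ e"
      using \<open>e > 0\<close> by (rule power_minus_mult)
    finally show ?thesis by (simp add: d)
  qed
qed

section \<open>The generic vector\<close>

abbreviation const_fract :: "'a::field \<Rightarrow> 'a mvpoly fract" where
  "const_fract c \<equiv> to_fract (const_poly c)"

abbreviation generic_coordinate :: "nat \<Rightarrow> 'a::field mvpoly fract" where
  "generic_coordinate j \<equiv> to_fract (var_poly (0, j))"

lemma var_poly_independent:
  fixes a :: "nat \<Rightarrow> 'a::field"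
  assumes "(\<Sum>j<n. const_poly (a j) * var_poly (i, j)) = 0" "j < n"
  shows "a j = 0"
proof -
  have "(\<Sum>k<n. const_poly (a k) * var_poly (i, k)) = (\<Sum>k<n. Poly_Mapping.single (Poly_Mapping.single (i, k) 1) (a k))"
    by (simp add: const_poly_def var_poly_def mult_single)
  then have "0 = Poly_Mapping.lookup (\<Sum>k<n. Poly_Mapping.single (Poly_Mapping.single (i, k) (1::nat)) (a k)) (Poly_Mapping.single (i, j) 1)"
    using assms(1) by simp
  also have "\<dots> = (\<Sum>k<n. if k = j then a k else 0)"
    unfolding lookup_sum by (intro sum.cong) (auto simp: lookup_single when_def dest: arg_cong[where f = Poly_Mapping.keys])
  finally show ?thesis using assms(2) by simp
qed

interpretation generic: independent_family
  "const_fract :: 'a::{field, finite} \<Rightarrow> 'a mvpoly fract" "CARD('a)" generic_coordinate n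
proof unfold_locales
  fix a :: "nat \<Rightarrow> 'a" and j
  assume "(\<Sum>j<n. const_fract (a j) * generic_coordinate j) = 0" "j < n"
  then have "to_fract (\<Sum>j<n. const_poly (a j) * var_poly (0, j) :: 'a mvpoly) = 0"
    by (simp add: to_fract.hom_sum)
  then have "(\<Sum>j<n. const_poly (a j) * var_poly (0, j)) = 0"
    unfolding to_fract_eq_0_iff .
  then show "a j = 0"
    using \<open>j < n\<close> by (rule var_poly_independent)
qed (simp_all add: const_poly.hom_add const_poly.hom_mult const_poly.hom_one const_poly.hom_zero)

lemma to_fract_det_moore_mat: "to_fract (det (moore_mat n)) = det (generic.moore n)"
proof -
  have "map_mat to_fract (moore_mat n) = generic.moore n"
    by (intro eq_matI) (auto simp: moore_mat_def generic.moore_def to_fract.hom_power)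
  then show ?thesis by (metis to_fract.hom_det)
qed

lemma to_fract_gen_det:
  "to_fract (gen_det n i k) = generic.cramer_det n (\<lambda>j. to_fract (gen_column n i j)) k"
proof -
  have "map_mat to_fract (replace_col (moore_mat n) (vec n (gen_column n i)) k)
      = replace_col (generic.moore n) (vec n (\<lambda>j. to_fract (gen_column n i j))) k"
    by (intro eq_matI) (auto simp: moore_mat_def generic.moore_def to_fract.hom_power replace_col_def)
  then show ?thesis
    unfolding gen_det_def generic.cramer_det_def by (metis to_fract.hom_det)
qed

section \<open>The field of invariants\<close>

text \<open>
This treats both groups at once: \<open>e\<close> is an exponent that kills all determinants of \<open>G\<close>, and \<open>allowed\<close>
describes determinants for which all row replacements occur in \<open>G\<close>. The condition that \<open>e\<close> divides \<open>q - 1\<close>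
puts \<open>L ^ (q - 1)\<close>, which is the first Cramer coefficient of \<open>x ^ q ^ n\<close> up to sign, into the field generated by
\<open>L ^ e\<close>.
\<close>

lemma invariant_field_generated:
  fixes scale :: "'a::{field, finite} \<Rightarrow> 'w::ab_group_add \<Rightarrow> 'w" and allowed :: "'a \<Rightarrow> bool"
  assumes basis: "ordered_basis scale n b"
    and m: "m > 0"
    and G: "G \<subseteq> GL_W scale" "\<And>g. g \<in> G \<Longrightarrow> det (matrix_of scale n b g) ^ e = 1"
    and e: "e > 0" "e dvd CARD('a) - 1"
    and elementary: "\<And>l r. l < n \<Longrightarrow> allowed (r l) \<Longrightarrow> \<exists>g\<in>G. \<forall>j<n. \<forall>k<n.
      based_space.inverse_matrix scale n b g j k = row_replacement l r j k"
    and allowed_1: "allowed 1"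
    and last: "(\<forall>c. c \<noteq> 0 \<longrightarrow> allowed c) \<or> e = 1"
  shows "(\<forall>i<m. \<forall>k. generator n e i k \<in> invariant_polys scale m n b G) \<and>
    invariant_field scale m n b G =
      gen_field (range const_fract \<union> to_fract ` {generator n e i k | i k. i < m \<and> k < n})"
proof -
  interpret based_space scale n b by unfold_locales (rule basis)
  define H :: "'a mvpoly fract set" where "H = to_fract ` {generator n e i k | i k. i < m \<and> k < n}"
  define K where "K = gen_field (range const_fract \<union> H)"
  define D :: "'a mvpoly fract set" where "D = frac_mW m n"
  interpret K: subfield_set K unfolding K_def by (rule subfield_set_gen_field)
  have D: "subfield_set D" unfolding D_def by (rule subfield_set_frac_mW)
  have K_incl: "range const_fract \<subseteq> K" "H \<subseteq> K"
    unfolding K_def by (auto intro: generate_field.incl)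

  let ?A = "inverse_matrix"
  have inj: "p = 0" if "g \<in> G" "p \<in> poly_mW m n" "lin_subst n (?A g) p = 0" for g p
  proof -
    obtain B where "matrices_inverse n (?A g) B"
      using matrices_inverse_commute[OF inverse_matrix(1)] G(1) \<open>g \<in> G\<close> by blast
    then have "lin_subst n B (lin_subst n (?A g) p) = p"
      using \<open>p \<in> poly_mW m n\<close> by (intro lin_subst_inverse) (auto simp: matrices_inverse_def)
    then show ?thesis using that(3) by (simp add: lin_subst.hom_zero)
  qed
  have endo: "subfield_endomorphism D (act_frac scale m n b g)" if "g \<in> G" for g
    unfolding D_def using subfield_endomorphism_act_frac[OF act_poly_eq inj[OF that]] by blast
  have act: "act_frac scale m n b g (to_fract p) = to_fract (lin_subst n (?A g) p)"
    if "g \<in> G" "p \<in> poly_mW m n" for g p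
    using act_frac_to_fract[OF act_poly_eq inj[OF that(1)] that(2)] by blast
  have det_inverse: "det (mat n n (\<lambda>(j, k). ?A g j k)) ^ e = 1" if "g \<in> G" for g
  proof -
    have "(det (matrix_of scale n b g) * det (mat n n (\<lambda>(j, k). ?A g j k))) ^ e = 1"
      using inverse_matrix(2)[of g] G(1) that by (metis power_one subsetD)
    then show ?thesis using G(2)[OF that] by (simp add: power_mult_distrib)
  qed
  have generator_fixed: "lin_subst n (?A g) (generator n e i k) = generator n e i k" if "g \<in> G" for g i k
    using det_inverse[OF that] e(1) by (rule lin_subst_generator)
  have invariant: "generator n e i k \<in> invariant_polys scale m n b G" if "i < m" for i k
    using that generator_mem generator_fixed by (simp add: invariant_polys_def act_poly_eq)

  have base_fixed: "act_frac scale m n b g c = c" if "g \<in> G" "c \<in> range const_fract \<union> H" for g c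
    using that(2)
  proof (elim UnE rangeE)
    fix a assume "c = const_fract a"
    then show ?thesis using act[OF that(1) poly_mW_const[of a]] by simp
  next
    assume "c \<in> H"
    then obtain i k where "i < m" "c = to_fract (generator n e i k)" by (auto simp: H_def)
    then show ?thesis
      using act[OF that(1) generator_mem[of i m n e k]] generator_fixed[OF that(1)] by simp
  qed
  have base_D: "range const_fract \<union> H \<subseteq> D"
    unfolding D_def H_def by (auto intro!: to_fract_mem_frac_mW poly_mW_const generator_mem)
  have "K \<subseteq> {x \<in> D. act_frac scale m n b g x = x}" if "g \<in> G" for g
    unfolding K_def using base_fixed[OF that] base_D
    by (intro gen_field_subset subfield_endomorphism.subfield_set_fixed endo that) auto
  moreover have "K \<subseteq> D"
    unfolding K_def by (intro gen_field_subset D base_D)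
  ultimately have "K \<subseteq> invariant_field scale m n b G"
    unfolding invariant_field_def D_def by blast

  moreover have "f \<in> K" if f: "f \<in> invariant_field scale m n b G" for f
  proof -
    let ?L = "det (generic.moore n) :: 'a mvpoly fract"
    let ?c = "\<lambda>i. generic.moore_coeff n (\<lambda>j. to_fract (gen_column n i j :: 'a mvpoly))"
    have L: "?L \<noteq> 0" by (rule generic.det_moore_nonzero[OF order_refl])
    have gen_K: "to_fract (generator n e i k) \<in> K" if "i < m" "k < n" for i k
      using that K_incl(2) by (auto simp: H_def)
    have Le: "?L ^ e \<in> K" if "n > 0"
      using gen_K[of 0 0] m that by (simp add: generator_def to_fract.hom_power to_fract_det_moore_mat)
    have coeff_K: "?c i k \<in> K" if "i < m" "k < n" for i k
    proof (cases "i = 0 \<and> k = 0")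
      case True
      have "n > 0" using that by simp
      obtain d where d: "CARD('a) - 1 = e * d" using e(2) by (auto elim: dvdE)
      have "?c 0 0 \<in> {?L ^ CARD('a) / ?L, - (?L ^ CARD('a) / ?L)}"
        using generic.cramer_det_frobenius_0[OF \<open>n > 0\<close>, where 'a = 'a]
        by (auto simp: generic.moore_coeff_def gen_column_def to_fract.hom_power)
      moreover have "?L ^ CARD('a) / ?L = (?L ^ e) ^ d"
      proof -
        have "CARD('a) = Suc (e * d)"
          using d zero_less_card_finite[where 'a = 'a] by linarith
        moreover have "u ^ Suc (e * d) / u = (u ^ e) ^ d" if "u \<noteq> 0" for u :: "'a mvpoly fract"
          using that by (simp add: power_mult)
        ultimately show ?thesis using L by metis
      qed
      ultimately show ?thesis
        using True K.power_mem[OF Le[OF \<open>n > 0\<close>], of d] K.uminus_mem by auto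
    next
      case False
      then have "to_fract (generator n e i k) = ?L ^ (e - 1) * generic.cramer_det n (\<lambda>j. to_fract (gen_column n i j)) k"
        by (auto simp: generator_def to_fract.hom_power to_fract.hom_mult to_fract_det_moore_mat to_fract_gen_det)
      moreover have "?L ^ e = ?L ^ (e - 1) * ?L"
        using power_minus_mult[OF e(1), of ?L] by simp
      ultimately have "?c i k = to_fract (generator n e i k) / ?L ^ e"
        using L by (simp add: generic.moore_coeff_def)
      then show ?thesis using gen_K[OF that] Le that K.divide_mem by auto
    qed

    define Kn where "Kn = gen_field (range const_fract \<union> H \<union> generic_coordinate ` {..<n})"
    interpret Kn: subfield_set Kn unfolding Kn_def by (rule subfield_set_gen_field)
    have K_Kn: "K \<subseteq> Kn" unfolding K_def Kn_def by (rule gen_field_mono) auto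
    have generic_Kn: "generic_coordinate j \<in> Kn" if "j < n" for j
      unfolding Kn_def using that by (intro generate_field.incl) auto
    have var_Kn: "to_fract (var_poly (i, j)) \<in> Kn" if "i < m" "j < n" for i j
    proof (cases "i = 0")
      case False
      have "to_fract (gen_column n i j :: 'a mvpoly) = (\<Sum>k<n. ?c i k * generic_coordinate j ^ CARD('a) ^ k)"
        by (rule generic.moore_coeff_expansion[OF that(2), where z = "\<lambda>j. to_fract (gen_column n i j)"])
      also have "\<dots> \<in> Kn"
        using coeff_K that K_Kn generic_Kn
        by (intro Kn.sum_mem Kn.mult_mem Kn.power_mem) auto
      finally show ?thesis using False by (simp add: gen_column_def)
    qed (use generic_Kn that in simp)
    have poly_Kn: "to_fract p \<in> Kn" if "p \<in> poly_mW m n" for p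
      using that
    proof (induction rule: poly_mW_induct)
      case (const c)
      then show ?case using K_incl K_Kn by auto
    qed (simp_all add: var_Kn Kn.add_mem Kn.mult_mem)
    have f_D: "f \<in> D" and f_fixed: "act_frac scale m n b g f = f" if "g \<in> G" for g
      using f that by (auto simp: invariant_field_def D_def)
    have "f \<in> frac_mW m n" using f by (simp add: invariant_field_def)
    then obtain p r where "f = Fract p r" "p \<in> poly_mW m n" "r \<in> poly_mW m n" "r \<noteq> 0"
      by (auto simp: frac_mW_def)
    then have "f = to_fract p / to_fract r" by (simp add: to_fract_def)
    then have f_Kn: "f \<in> Kn"
      using poly_Kn \<open>p \<in> _\<close> \<open>r \<in> _\<close> Kn.divide_mem by simp

    show "f \<in> K"
      unfolding K_def
    proof (rule generic.mem_base_field_if_fixed[where allowed = allowed and D = D])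
      show "f \<in> gen_field (range const_fract \<union> H \<union> generic_coordinate ` {..<n})"
        using f_Kn by (simp add: Kn_def)
      show "generic.moore_coeff n (\<lambda>j. generic_coordinate j ^ CARD('a) ^ n) k
          \<in> gen_field (range const_fract \<union> H)" if "k < n" for k
        using coeff_K[OF m that] by (simp add: gen_column_def to_fract.hom_power K_def)
      show "(\<forall>c. c \<noteq> 0 \<longrightarrow> allowed c) \<or> ?L \<in> gen_field (range const_fract \<union> H)"
      proof (cases "n = 0")
        case True
        then show ?thesis using K.one_mem by (simp add: generic.moore_def K_def)
      next
        case False
        then show ?thesis using last Le by (auto simp: K_def)
      qed
      show "range const_fract \<union> H \<union> generic_coordinate ` {..<n} \<subseteq> D"
        using base_D m by (auto simp: D_def intro!: to_fract_mem_frac_mW poly_mW_var)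
      show "\<exists>\<sigma>. subfield_endomorphism D \<sigma> \<and> (\<forall>c\<in>range const_fract \<union> H. \<sigma> c = c) \<and> \<sigma> f = f \<and>
          (\<forall>i<n. i \<noteq> l \<longrightarrow> \<sigma> (generic_coordinate i) = generic_coordinate i) \<and>
          \<sigma> (generic_coordinate l) = generic.comb n r"
        if l: "l < n" "allowed (r l)" for l r
      proof -
        obtain g where g: "g \<in> G" "\<And>j k. j < n \<Longrightarrow> k < n \<Longrightarrow> ?A g j k = row_replacement l r j k"
          using elementary[of l r] l by blast
        have coordinate: "act_frac scale m n b g (generic_coordinate j)
            = (\<Sum>k<n. const_fract (row_replacement l r j k) * generic_coordinate k)" if "j < n" for j
          using that m g
          by (simp add: act poly_mW_var lin_subst_var to_fract.hom_sum to_fract.hom_mult)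
        have "act_frac scale m n b g (generic_coordinate i) = generic_coordinate i" if "i < n" "i \<noteq> l" for i
        proof -
          have "act_frac scale m n b g (generic_coordinate i)
              = (\<Sum>k<n. if k = i then generic_coordinate k else 0)"
            unfolding coordinate[OF that(1)] using that(2)
            by (intro sum.cong) (auto simp: row_replacement_def const_poly.hom_zero const_poly.hom_one)
          then show ?thesis using that by simp
        qed
        moreover have "act_frac scale m n b g (generic_coordinate l) = generic.comb n r"
          unfolding coordinate[OF l(1)] by (simp add: generic.comb_def row_replacement_def)
        ultimately show ?thesis
          using endo base_fixed f_fixed g(1) by blast
      qed
    qed (use D allowed_1 in auto)
  qed
  ultimately show ?thesis
    using invariant unfolding K_def H_def by blast
qed

theorem theorem1p2:
  fixes scale :: "'a::{field, finite} \<Rightarrow> 'w::ab_group_add \<Rightarrow> 'w"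
    and m n :: nat
    and b :: "nat \<Rightarrow> 'w"
    and G :: "('w \<Rightarrow> 'w) set"
  assumes "m > 0"
    and "ordered_basis scale n b"
    and "G \<in> {GL_W scale, SL_W scale n b}"
  shows "\<exists>f :: nat \<Rightarrow> 'a mvpoly.
    (\<forall>i < m * n. f i \<in> invariant_polys scale m n b G \<and> homogeneous_poly (f i)) \<and>
    invariant_field scale m n b G = field_gen_by (f ` {..<m * n})"
proof -
  interpret based_space scale n b by unfold_locales (rule assms(2))
  have card: "CARD('a) > 1"
    by (rule mvpoly_algebra.q_gt_1)
  have unit_power: "c ^ (CARD('a) - 1) = 1" if "c \<noteq> 0" for c :: 'a
  proof -
    have "c ^ (CARD('a) - 1) * c = 1 * c"
      using power_card_eq_same[of c] power_minus_mult[of "CARD('a)" c] card by simp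
    then show ?thesis using that by (metis mult_cancel_right)
  qed
  have "\<exists>e. (\<forall>i<m. \<forall>k. generator n e i k \<in> invariant_polys scale m n b G) \<and>
    invariant_field scale m n b G =
      gen_field (range const_fract \<union> to_fract ` {generator n e i k | i k. i < m \<and> k < n})"
    using assms(3)
  proof (elim insertE emptyE)
    assume G: "G = GL_W scale"
    show ?thesis
    proof (rule exI, rule invariant_field_generated[where e = "CARD('a) - 1" and allowed = "\<lambda>c. c \<noteq> 0"])
      show "det (matrix_of scale n b g) ^ (CARD('a) - 1) = 1" if "g \<in> G" for g
        using inverse_matrix(2)[of g] that G by (intro unit_power) auto
      show "\<exists>g\<in>G. \<forall>j<n. \<forall>k<n. inverse_matrix g j k = row_replacement l r j k"
        if "l < n" "r l \<noteq> 0" for l r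
        using elementary_element[of l r, OF that] G by metis
    qed (use assms G card in auto)
  next
    assume G: "G = SL_W scale n b"
    show ?thesis
    proof (rule exI, rule invariant_field_generated[where e = 1 and allowed = "\<lambda>c. c = 1"])
      show "\<exists>g\<in>G. \<forall>j<n. \<forall>k<n. inverse_matrix g j k = row_replacement l r j k"
        if "l < n" "r l = 1" for l r
        using elementary_element[of l r] that G by (metis one_neq_zero)
    qed (use assms G in \<open>auto simp: SL_W_def\<close>)
  qed
  then obtain e where e: "\<And>i k. i < m \<Longrightarrow> generator n e i k \<in> invariant_polys scale m n b G"
    "invariant_field scale m n b G =
      gen_field (range const_fract \<union> to_fract ` {generator n e i k | i k. i < m \<and> k < n})"
    by blast
  define f :: "nat \<Rightarrow> 'a mvpoly" where "f l = generator n e (l div n) (l mod n)" for l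
  have "f l \<in> invariant_polys scale m n b G" if "l < m * n" for l
    using that by (simp add: f_def e(1) less_mult_imp_div_less)
  moreover have "homogeneous_poly (f l)" for l
    by (simp add: f_def homogeneous_generator)
  moreover have "f ` {..<m * n} = {generator n e i k | i k. i < m \<and> k < n}"
  proof (intro equalityI subsetI)
    fix p :: "'a mvpoly" assume "p \<in> f ` {..<m * n}"
    then obtain l where "l < m * n" "p = f l" by auto
    moreover from this have "n > 0" by (cases n) auto
    ultimately show "p \<in> {generator n e i k | i k. i < m \<and> k < n}"
      unfolding f_def using less_mult_imp_div_less[of l m n] mod_less_divisor[of n l] by blast
  next
    fix p :: "'a mvpoly" assume "p \<in> {generator n e i k | i k. i < m \<and> k < n}"
    then obtain i k where ik: "i < m" "k < n" "p = generator n e i k" by auto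
    have "i * n + k < Suc i * n" using ik by simp
    also have "\<dots> \<le> m * n" using ik by (intro mult_le_mono1) simp
    finally show "p \<in> f ` {..<m * n}"
      using ik by (intro image_eqI[of _ _ "i * n + k"]) (simp_all add: f_def)
  qed
  ultimately show ?thesis
    using e(2) by (intro exI[of _ f]) (simp add: field_gen_by_def to_fract_def)
qed

end
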